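(* Let $q\ge 2$ be an integer, let $\pi_q$ be a projective plane of order $q$, and let $n_q=q^2+q+1$. Then $C_k \hookrightarrow \pi_q$ for all integers $k$ with $3\le k\le n_q$.
   Context: A partial plane is an incidence structure of points and lines in which any two distinct points lie on at most one common line and every line contains at least two points. A projective plane of order $q\ge 2$ is a partial plane in which every point is on exactly $q+1$ lines, every line contains exactly $q+1$ points, and there are four points no three of which are collinear (it then has $q^2+q+1$ points and $q^2+q+1$ lines). The plane is arbitrary (not assumed to be coordinatized by a field). For a graph $G$ (finite, simple, undirected) and a partial plane $\pi$ with point set $\mathcal{P}$ and line set $\mathcal{L}$, an embedding of $G$ in $\pi$ is an injective map $f: V(G)\cup E(G)\to \mathcal{P}\cup\mathcal{L}$ with $f(V(G))\subset \mathcal{P}$, $f(E(G))\subset\mathcal{L}$, such that whenever a vertex $x$ is incident with an edge $e$ in $G$, the point $f(x)$ is incident with the line $f(e)$ in $\pi$. We write $G\hookrightarrow \pi$ if such an embedding exists. $C_k$ denotes the cycle graph on $k$ vertices. (So $C_k\hookrightarrow\pi$ means there are $k$ distinct points $P_1,\dots,P_k$ such that the lines $P_1P_2, P_2P_3,\dots,P_{k-1}P_k,P_kP_1$ exist and are $k$ distinct lines.)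
   Formalization: The definition of projective plane here also requires that any two distinct points lie on a common line (equivalently, that there are q²+q+1 points); without this, generalized quadrangles such as GQ(2,2) would qualify, and they contain no triangle. *)

theory Defs
  imports Main
begin

section \<open>Graphs\<close>

record 'v ugraph =
  verts :: "'v set"
  edges :: "'v set set"

definition finite_simple_graph :: "'v ugraph \<Rightarrow> bool" where
  "finite_simple_graph G \<longleftrightarrow>
     finite (verts G) \<and> (\<forall>e\<in>edges G. e \<subseteq> verts G \<and> card e = 2)"

text \<open>This is the cycle on \<open>k\<close> vertices for \<open>k \<ge> 3\<close> only.\<close>

definition cycle_graph :: "nat \<Rightarrow> nat ugraph" where
  "cycle_graph k = \<lparr>verts = {..<k}, edges = (\<lambda>i. {i, Suc i mod k}) ` {..<k}\<rparr>"

section \<open>Partial planes and projective planes\<close>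

record ('p, 'l) incidence_structure =
  points :: "'p set"
  lines :: "'l set"
  incident :: "'p \<Rightarrow> 'l \<Rightarrow> bool"

definition points_on :: "('p, 'l) incidence_structure \<Rightarrow> 'l \<Rightarrow> 'p set" where
  "points_on \<pi> l = {p \<in> points \<pi>. incident \<pi> p l}"

definition lines_through :: "('p, 'l) incidence_structure \<Rightarrow> 'p \<Rightarrow> 'l set" where
  "lines_through \<pi> p = {l \<in> lines \<pi>. incident \<pi> p l}"

definition collinear :: "('p, 'l) incidence_structure \<Rightarrow> 'p set \<Rightarrow> bool" where
  "collinear \<pi> S \<longleftrightarrow> (\<exists>l\<in>lines \<pi>. S \<subseteq> points_on \<pi> l)"

definition partial_plane :: "('p, 'l) incidence_structure \<Rightarrow> bool" where
  "partial_plane \<pi> \<longleftrightarrow>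
     (\<forall>a\<in>points \<pi>. \<forall>b\<in>points \<pi>. a \<noteq> b \<longrightarrow>
        (\<forall>l\<in>lines \<pi>. \<forall>m\<in>lines \<pi>.
           incident \<pi> a l \<and> incident \<pi> b l \<and> incident \<pi> a m \<and> incident \<pi> b m \<longrightarrow> l = m)) \<and>
     (\<forall>l\<in>lines \<pi>. \<exists>a\<in>points_on \<pi> l. \<exists>b\<in>points_on \<pi> l. a \<noteq> b)"

definition regular_plane :: "nat \<Rightarrow> ('p, 'l) incidence_structure \<Rightarrow> bool" where
  "regular_plane q \<pi> \<longleftrightarrow>
     (\<forall>p\<in>points \<pi>. card (lines_through \<pi> p) = q + 1) \<and>
     (\<forall>l\<in>lines \<pi>. card (points_on \<pi> l) = q + 1)"

definition has_quadrangle :: "('p, 'l) incidence_structure \<Rightarrow> bool" where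
  "has_quadrangle \<pi> \<longleftrightarrow>
     (\<exists>S\<subseteq>points \<pi>. card S = 4 \<and> (\<forall>T\<subseteq>S. card T = 3 \<longrightarrow> \<not> collinear \<pi> T))"

text \<open>
  The condition that any two points are joined by a line has to be required explicitly: a
  generalized quadrangle of order \<open>(q, q)\<close> is a partial plane with \<open>q + 1\<close> points on each line,
  \<open>q + 1\<close> lines through each point and a quadrangle, but has \<open>(q + 1) * (q\<^sup>2 + 1)\<close> points and no
  triangles. Given the other conditions, it is equivalent to the plane having \<open>q\<^sup>2 + q + 1\<close>
  points; see \<open>projective_plane_of_order_iff_card_points\<close>.
\<close>

definition projective_plane_of_order :: "nat \<Rightarrow> ('p, 'l) incidence_structure \<Rightarrow> bool" where
  "projective_plane_of_order q \<pi> \<longleftrightarrow>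
     partial_plane \<pi> \<and>
     (\<forall>a\<in>points \<pi>. \<forall>b\<in>points \<pi>. a \<noteq> b \<longrightarrow>
        (\<exists>l\<in>lines \<pi>. incident \<pi> a l \<and> incident \<pi> b l)) \<and>
     regular_plane q \<pi> \<and>
     has_quadrangle \<pi>"

section \<open>Embeddings\<close>

text \<open>
  The disjoint unions \<open>V(G) \<union> E(G)\<close> and \<open>P \<union> L\<close> are rendered by sums, so that an embedding is a
  single map defined on both vertices and edges.
\<close>

definition is_embedding ::
  "'v ugraph \<Rightarrow> ('p, 'l) incidence_structure \<Rightarrow> ('v + 'v set \<Rightarrow> 'p + 'l) \<Rightarrow> bool" where
  "is_embedding G \<pi> f \<longleftrightarrow>
     inj_on f (verts G <+> edges G) \<and>
     f ` Inl ` verts G \<subseteq> Inl ` points \<pi> \<and>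
     f ` Inr ` edges G \<subseteq> Inr ` lines \<pi> \<and>
     (\<forall>x\<in>verts G. \<forall>e\<in>edges G. x \<in> e \<longrightarrow>
        incident \<pi> (projl (f (Inl x))) (projr (f (Inr e))))"

definition embeds :: "'v ugraph \<Rightarrow> ('p, 'l) incidence_structure \<Rightarrow> bool"
    (infix "\<hookrightarrow>" 50) where
  "G \<hookrightarrow> \<pi> \<longleftrightarrow> (\<exists>f. is_embedding G \<pi> f)"

section \<open>Basic consequences\<close>

lemma finite_simple_graph_cycle_graph:
  assumes "3 \<le> k"
  shows "finite_simple_graph (cycle_graph k)"
proof -
  have "i \<noteq> Suc i mod k" "Suc i mod k < k" if "i < k" for i
    using assms that by (auto simp: mod_Suc)
  then show ?thesis
    by (auto simp: finite_simple_graph_def cycle_graph_def card_insert_if)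
qed

lemma cycle_edge_inj:
  assumes "3 \<le> k"
  shows "inj_on (\<lambda>i. {i, Suc i mod k}) {..<k}"
proof (rule inj_onI)
  fix i j assume ij: "i \<in> {..<k}" "j \<in> {..<k}" "{i, Suc i mod k} = {j, Suc j mod k}"
  show "i = j"
  proof (rule ccontr)
    assume "i \<noteq> j"
    then have "i = Suc j mod k" "j = Suc i mod k"
      using ij(3) by (auto simp: doubleton_eq_iff)
    moreover have "i < k" "j < k" using ij by auto
    moreover have "Suc n mod k = (if Suc n = k then 0 else Suc n)" if "n < k" for n
      using that by auto
    ultimately show False using assms by (auto split: if_splits)
  qed
qed

lemma cycle_graph_embeds_iff:
  assumes k: "3 \<le> k"
  shows "cycle_graph k \<hookrightarrow> \<pi> \<longleftrightarrow>
    (\<exists>p l. inj_on p {..<k} \<and> inj_on l {..<k} \<and>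
       (\<forall>i<k. p i \<in> points \<pi> \<and> l i \<in> lines \<pi> \<and>
          incident \<pi> (p i) (l i) \<and> incident \<pi> (p (Suc i mod k)) (l i)))"
    (is "_ \<longleftrightarrow> ?R")
proof
  let ?e = "\<lambda>i. {i, Suc i mod k}"
  assume "cycle_graph k \<hookrightarrow> \<pi>"
  then obtain f where f: "is_embedding (cycle_graph k) \<pi> f"
    by (auto simp: embeds_def)
  define p where "p i = projl (f (Inl i))" for i
  define l where "l i = projr (f (Inr (?e i)))" for i
  have inj: "inj_on f ({..<k} <+> ?e ` {..<k})"
    using f by (simp add: is_embedding_def cycle_graph_def)
  have "f (Inl i) \<in> Inl ` points \<pi>" if "i < k" for i
    using f that by (auto simp: is_embedding_def cycle_graph_def image_subset_iff)
  then have p: "f (Inl i) = Inl (p i)" "p i \<in> points \<pi>" if "i < k" for i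
    using that by (fastforce simp: p_def)+
  have "f (Inr (?e i)) \<in> Inr ` lines \<pi>" if "i < k" for i
    using f that by (auto simp: is_embedding_def cycle_graph_def image_subset_iff)
  then have l: "f (Inr (?e i)) = Inr (l i)" "l i \<in> lines \<pi>" if "i < k" for i
    using that by (fastforce simp: l_def)+
  have inc: "incident \<pi> (p i) (l j)" if "i < k" "j < k" "i \<in> ?e j" for i j
    using f that unfolding is_embedding_def cycle_graph_def p_def l_def by auto
  have "inj_on p {..<k}"
  proof (rule inj_onI)
    fix i j assume ij: "i \<in> {..<k}" "j \<in> {..<k}" "p i = p j"
    then have "f (Inl i) = f (Inl j)" using p by simp
    then show "i = j" using inj ij(1,2) by (auto dest!: inj_onD)
  qed
  moreover have "inj_on l {..<k}"
  proof (rule inj_onI)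
    fix i j assume ij: "i \<in> {..<k}" "j \<in> {..<k}" "l i = l j"
    then have "f (Inr (?e i)) = f (Inr (?e j))" using l by simp
    then have "Inr (?e i) = (Inr (?e j) :: nat + nat set)"
      by (rule inj_onD[OF inj]) (use ij in auto)
    then show "i = j"
      using inj_onD[OF cycle_edge_inj[OF k] _ ij(1,2)] by simp
  qed
  moreover have "Suc i mod k < k" for i using k by simp
  ultimately show ?R using p l inc by blast
next
  let ?e = "\<lambda>i. {i, Suc i mod k}"
  assume ?R
  then obtain p l where pl: "inj_on p {..<k}" "inj_on l {..<k}"
    "\<And>i. i < k \<Longrightarrow> p i \<in> points \<pi> \<and> l i \<in> lines \<pi> \<and>
          incident \<pi> (p i) (l i) \<and> incident \<pi> (p (Suc i mod k)) (l i)"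
    by blast
  define f where "f = case_sum (\<lambda>i. Inl (p i)) (\<lambda>e. Inr (l (the_inv_into {..<k} ?e e)))"
  have e: "f (Inr (?e i)) = Inr (l i)" if "i < k" for i
    using the_inv_into_f_f[OF cycle_edge_inj[OF k], of i] that by (simp add: f_def)
  have v: "f (Inl i) = Inl (p i)" for i by (simp add: f_def)
  have "is_embedding (cycle_graph k) \<pi> f"
    unfolding is_embedding_def
  proof (intro conjI)
    show "inj_on f (verts (cycle_graph k) <+> edges (cycle_graph k))"
    proof -
      have "i = j" if "l i = l j" "i < k" "j < k" for i j
        using inj_onD[OF pl(2) that(1)] that(2,3) by simp
      moreover have "i = j" if "p i = p j" "i < k" "j < k" for i j
        using inj_onD[OF pl(1) that(1)] that(2,3) by simp
      ultimately show ?thesis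
        unfolding inj_on_def cycle_graph_def by (fastforce simp: v e)
    qed
    show "f ` Inl ` verts (cycle_graph k) \<subseteq> Inl ` points \<pi>"
      using pl(3) by (auto simp: cycle_graph_def v)
    show "f ` Inr ` edges (cycle_graph k) \<subseteq> Inr ` lines \<pi>"
      using pl(3) by (auto simp: cycle_graph_def e)
    show "\<forall>x\<in>verts (cycle_graph k). \<forall>e\<in>edges (cycle_graph k). x \<in> e \<longrightarrow>
        incident \<pi> (projl (f (Inl x))) (projr (f (Inr e)))"
      using pl(3) by (auto simp: cycle_graph_def v e)
  qed
  then show "cycle_graph k \<hookrightarrow> \<pi>" by (auto simp: embeds_def)
qed

lemma card_joined_points:
  assumes "partial_plane \<pi>" "regular_plane q \<pi>" "a \<in> points \<pi>"
  defines "N \<equiv> (\<Union>l\<in>lines_through \<pi> a. points_on \<pi> l)"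
  shows "finite N" "card N = q\<^sup>2 + q + 1" "N \<subseteq> points \<pi>" "a \<in> N"
proof -
  let ?A = "\<lambda>l. points_on \<pi> l - {a}"
  let ?M = "\<Union>l\<in>lines_through \<pi> a. ?A l"
  have cl: "card (lines_through \<pi> a) = q + 1"
    using assms by (simp add: regular_plane_def)
  then have fl: "finite (lines_through \<pi> a)" by (intro card_ge_0_finite) simp
  have cp: "card (points_on \<pi> l) = q + 1" if "l \<in> lines_through \<pi> a" for l
    using assms that by (auto simp: regular_plane_def lines_through_def)
  then have fp: "finite (points_on \<pi> l)" if "l \<in> lines_through \<pi> a" for l
    by (intro card_ge_0_finite) (simp add: that)
  have a_on: "a \<in> points_on \<pi> l" if "l \<in> lines_through \<pi> a" for l
    using assms that by (auto simp: points_on_def lines_through_def)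
  have cA: "card (?A l) = q" if "l \<in> lines_through \<pi> a" for l
    using that cp fp a_on by simp
  have "?A l \<inter> ?A m = {}"
    if "l \<in> lines_through \<pi> a" "m \<in> lines_through \<pi> a" "l \<noteq> m" for l m
    using assms(1,3) that unfolding partial_plane_def points_on_def lines_through_def by blast
  then have "card ?M = (\<Sum>l\<in>lines_through \<pi> a. card (?A l))"
    using fl fp by (intro card_UN_disjoint) auto
  also have "\<dots> = (q + 1) * q" using cA cl by simp
  finally have cM: "card ?M = (q + 1) * q" .
  obtain l where "l \<in> lines_through \<pi> a" using cl by (cases "lines_through \<pi> a = {}") auto
  then show "a \<in> N" using a_on by (auto simp: N_def)
  then have N: "N = insert a ?M" by (auto simp: N_def)
  have fM: "finite ?M" using fl fp by auto
  then show "finite N" by (simp add: N)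
  have "card N = Suc (card ?M)" unfolding N using fM by (intro card_insert_disjoint) auto
  then show "card N = q\<^sup>2 + q + 1" using cM by (simp add: power2_eq_square)
  show "N \<subseteq> points \<pi>" by (auto simp: N_def points_on_def)
qed

lemma has_quadrangle_nonempty: "has_quadrangle \<pi> \<Longrightarrow> points \<pi> \<noteq> {}"
  by (auto simp: has_quadrangle_def)

lemma projective_plane_of_order_iff_card_points:
  "projective_plane_of_order q \<pi> \<longleftrightarrow>
     partial_plane \<pi> \<and> regular_plane q \<pi> \<and> has_quadrangle \<pi> \<and> card (points \<pi>) = q\<^sup>2 + q + 1"
proof -
  let ?N = "\<lambda>a. \<Union>l\<in>lines_through \<pi> a. points_on \<pi> l"
  let ?J = "\<forall>a\<in>points \<pi>. \<forall>b\<in>points \<pi>. a \<noteq> b \<longrightarrow>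
              (\<exists>l\<in>lines \<pi>. incident \<pi> a l \<and> incident \<pi> b l)"
  have "?J \<longleftrightarrow> card (points \<pi>) = q\<^sup>2 + q + 1"
    if \<pi>: "partial_plane \<pi>" "regular_plane q \<pi>" "has_quadrangle \<pi>"
  proof
    assume J: ?J
    obtain a where a: "a \<in> points \<pi>" using has_quadrangle_nonempty[OF \<pi>(3)] by blast
    have "points \<pi> \<subseteq> ?N a"
    proof
      fix b assume b: "b \<in> points \<pi>"
      show "b \<in> ?N a"
        using J a b card_joined_points(4)[OF \<pi>(1,2) a]
        by (cases "a = b") (auto simp: lines_through_def points_on_def)
    qed
    then have "points \<pi> = ?N a" using card_joined_points(3)[OF \<pi>(1,2) a] by blast
    then show "card (points \<pi>) = q\<^sup>2 + q + 1" using card_joined_points(2)[OF \<pi>(1,2) a] by simp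
  next
    assume c: "card (points \<pi>) = q\<^sup>2 + q + 1"
    then have "finite (points \<pi>)" by (intro card_ge_0_finite) simp
    then have "?N a = points \<pi>" if "a \<in> points \<pi>" for a
      using card_joined_points[OF \<pi>(1,2) that] c by (intro card_subset_eq) auto
    then show ?J unfolding lines_through_def points_on_def by blast
  qed
  then show ?thesis unfolding projective_plane_of_order_def by blast
qed

lemma card_lines_projective_plane:
  assumes "projective_plane_of_order q \<pi>"
  shows "card (lines \<pi>) = q\<^sup>2 + q + 1"
proof -
  have pp: "partial_plane \<pi>" and reg: "regular_plane q \<pi>" and cP: "card (points \<pi>) = q\<^sup>2 + q + 1"
    using assms by (auto simp: projective_plane_of_order_iff_card_points)
  have fP: "finite (points \<pi>)" using cP by (intro card_ge_0_finite) simp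
  have cl: "card (lines_through \<pi> a) = q + 1" if "a \<in> points \<pi>" for a
    using reg that by (simp add: regular_plane_def)
  have "finite (lines_through \<pi> a)" if "a \<in> points \<pi>" for a
    using cl[OF that] by (intro card_ge_0_finite) simp
  moreover have "lines \<pi> \<subseteq> (\<Union>a\<in>points \<pi>. lines_through \<pi> a)"
    using pp unfolding partial_plane_def points_on_def lines_through_def by blast
  ultimately have fL: "finite (lines \<pi>)" using fP by (auto intro: finite_subset)
  have "(\<Sum>a\<in>points \<pi>. card {l \<in> lines \<pi>. incident \<pi> a l}) = (q + 1) * card (lines \<pi>)"
    using reg by (intro sum_multicount fP fL) (auto simp: regular_plane_def points_on_def)
  moreover have "(\<Sum>a\<in>points \<pi>. card {l \<in> lines \<pi>. incident \<pi> a l}) = (q + 1) * card (points \<pi>)"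
    using cl by (simp add: lines_through_def)
  ultimately show ?thesis using cP by (metis mult_left_cancel add_is_0 one_neq_zero)
qed

end

theory Submission
  imports Defs
begin

text \<open>
  Fix a line \<open>axis\<close> and a point \<open>apex\<close> on it, and number the other points of \<open>axis\<close> as
  \<open>dir 0, \<dots>, dir (q - 1)\<close> and the other lines through \<open>apex\<close> as \<open>par 0, \<dots>, par (q - 1)\<close>. The \<open>q\<^sup>2\<close>
  points off the axis fall into \<open>q\<close> rows, one on each line \<open>par i\<close>. A point \<open>p\<close> of row \<open>i\<close> owns the
  line \<open>out p\<close> that joins it to \<open>dir i\<close>, and \<open>nxt p\<close> is the point where \<open>out p\<close> meets the next row,
  counted modulo \<open>q\<close>. A line not through \<open>apex\<close> meets the axis in a single point \<open>dir i\<close>, which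
  betrays the row of its owner and hence the owner; so different points own different lines.
  Moreover \<open>nxt\<close> is a permutation, and following \<open>p, out p, nxt p, \<dots>\<close> splits the points off the
  axis and the lines they own into closed cycles, the spirals (\<open>orbit_cycle\<close>). The points \<open>apex\<close>,
  \<open>dir i\<close> and the lines \<open>axis\<close>, \<open>par i\<close> are left over, and serve to join the spirals.
  
  For lengths up to \<open>q\<^sup>2 + 2\<close>, run through the spirals one after the other. A spiral entered in row
  \<open>d > 0\<close> ends in row \<open>d - 1\<close>, from where the line \<open>par (d - 1)\<close> leads to the next spiral. Entering
  the first one in row \<open>0\<close>, one uses \<open>par (q - 1), par (q - 2), \<dots>\<close>; as every spiral meets row \<open>0\<close>,
  there are at most \<open>q\<close> spirals, and \<open>par 0\<close> is never reached. At any point \<open>z\<close> the walk can be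
  closed by \<open>out z, dir (row z), axis, apex, par 0\<close>, because \<open>out z\<close> is only used on leaving \<open>z\<close>
  (\<open>close_path\<close>, \<open>trail_extend\<close>). This adds two points to the visited ones, of which there may be
  any number between \<open>1\<close> and \<open>q\<^sup>2\<close>.
  
  For length \<open>q\<^sup>2 + t + 2\<close> with \<open>t < q\<close>, prepare the spirals by treating the rows \<open>j < t\<close> in turn: for
  two points \<open>p, p'\<close> of row \<open>j\<close>, give up the incidences of \<open>out p\<close> with \<open>nxt p\<close> and of \<open>out p'\<close> with
  \<open>nxt p'\<close>, join the two lines through \<open>dir j\<close> and the two points by \<open>par (j + 1)\<close>. This adds one
  point. If \<open>p, p'\<close> lie on two different cycles, these are merged (\<open>ring_merge\<close>). If there is only
  one cycle left and it runs through both incidences in the same direction, it stays one cycle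
  (\<open>ring_twist\<close>). Such a pair exists: the first time because all points are still traversed in the
  direction of \<open>nxt\<close>, and later because \<open>q \<ge> 3\<close> and two of three points agree. Finally the walk
  through the merged cycle and the remaining spirals is closed as before.
\<close>

section \<open>Cyclic lists\<close>

definition steps :: "'a list \<Rightarrow> ('a \<times> 'a) set" where
  "steps xs = set (zip xs (tl xs))"

text \<open>
  A list stands both for a walk and for the cycle that returns from its last to its first entry.
  The relation \<open>steps\<close> belongs to the walk and \<open>arcs\<close> to the cycle; \<open>links\<close> forgets the direction of
  travel.
\<close>

definition arcs :: "'a list \<Rightarrow> ('a \<times> 'a) set" where
  "arcs xs = insert (last xs, hd xs) (steps xs)"

definition links :: "'a list \<Rightarrow> ('a \<times> 'a) set" where
  "links xs = arcs xs \<union> (arcs xs)\<inverse>"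

lemma steps_simps [simp]:
  "steps [] = {}" "steps [x] = {}" "steps (x # y # zs) = insert (x, y) (steps (y # zs))"
  by (auto simp: steps_def)

lemma steps_Cons: "ys \<noteq> [] \<Longrightarrow> steps (x # ys) = insert (x, hd ys) (steps ys)"
  by (cases ys) auto

lemma steps_append:
  assumes "xs \<noteq> []" "ys \<noteq> []"
  shows "steps (xs @ ys) = steps xs \<union> insert (last xs, hd ys) (steps ys)"
  using assms(1)
proof (induction xs rule: induct_list012)
  case (2 x)
  then show ?case using assms(2) by (cases ys) auto
qed auto

lemma steps_rev: "steps (rev xs) = (steps xs)\<inverse>"
proof (induction xs rule: induct_list012)
  case (3 x y zs)
  have "steps (rev (x # y # zs)) = steps (rev (y # zs) @ [x])" by simp
  also have "\<dots> = insert (y, x) (steps (rev (y # zs)))"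
    by (subst steps_append) auto
  finally show ?case using 3 by auto
qed auto

lemma steps_split:
  assumes "(x, y) \<in> steps xs"
  obtains us vs where "xs = us @ vs" "us \<noteq> []" "vs \<noteq> []" "last us = x" "hd vs = y"
proof -
  have "\<exists>us vs. xs = us @ vs \<and> us \<noteq> [] \<and> vs \<noteq> [] \<and> last us = x \<and> hd vs = y"
    using assms
  proof (induction xs rule: induct_list012)
    case (3 a b zs)
    show ?case
    proof (cases "(x, y) = (a, b)")
      case True
      then show ?thesis by (intro exI[of _ "[a]"] exI[of _ "b # zs"]) auto
    next
      case False
      then obtain us vs where "b # zs = us @ vs" "us \<noteq> []" "vs \<noteq> []" "last us = x" "hd vs = y"
        using 3 by auto
      then show ?thesis by (intro exI[of _ "a # us"] exI[of _ vs]) auto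
    qed
  qed auto
  then show ?thesis using that by blast
qed

lemma steps_arcs: "steps xs \<subseteq> arcs xs"
  by (auto simp: arcs_def)

lemma steps_links: "steps xs \<subseteq> links xs"
  by (auto simp: links_def arcs_def)

lemma arcs_rotate: "arcs (vs @ us) = arcs (us @ vs)"
  by (cases "us = []"; cases "vs = []") (auto simp: arcs_def steps_append)

lemma arcs_rev: "W \<noteq> [] \<Longrightarrow> arcs (rev W) = (arcs W)\<inverse>"
  by (auto simp: arcs_def steps_rev hd_rev last_rev)

text \<open>
  A cycle may be opened at any of its arcs without changing it as a cycle. If only a link is given,
  the cycle is reversed when necessary.
\<close>

lemma cut_arc:
  assumes "(x, y) \<in> arcs W" "W \<noteq> []"
  obtains W' where "hd W' = y" "last W' = x" "arcs W' = arcs W" "set W' = set W"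
    "distinct W' = distinct W" "length W' = length W"
proof (cases "(x, y) \<in> steps W")
  case True
  then obtain us vs where "W = us @ vs" "us \<noteq> []" "vs \<noteq> []" "last us = x" "hd vs = y"
    by (rule steps_split)
  then show ?thesis by (intro that[of "vs @ us"]) (auto simp: arcs_rotate)
next
  case False
  then show ?thesis using assms by (intro that[of W]) (auto simp: arcs_def)
qed

lemma cut_link:
  assumes "(x, y) \<in> links W" "W \<noteq> []"
  obtains W' where "hd W' = y" "last W' = x" "links W' = links W" "set W' = set W"
    "distinct W' = distinct W" "length W' = length W"
proof (cases "(x, y) \<in> arcs W")
  case True
  then show ?thesis by (rule cut_arc) (use assms that in \<open>auto simp: links_def\<close>)
next
  case False
  then have "(x, y) \<in> arcs (rev W)" using assms by (auto simp: links_def arcs_rev)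
  then obtain W' where "hd W' = y" "last W' = x" "arcs W' = arcs (rev W)" "set W' = set W"
    "distinct W' = distinct W" "length W' = length W"
    using assms(2) by (auto elim: cut_arc)
  moreover from this have "links W' = links W" using assms(2) by (auto simp: links_def arcs_rev)
  ultimately show ?thesis using that by blast
qed

text \<open>
  The two exchanges of the proof are the same list operation. If \<open>X\<close> and \<open>Y\<close> are two cycles, each
  opened at one arc, it merges them through \<open>u\<close> and \<open>v\<close>. If \<open>Y @ X\<close> is one cycle, it reroutes it at the
  arcs from \<open>last Y\<close> to \<open>hd X\<close> and from \<open>last X\<close> to \<open>hd Y\<close>; the reversal of \<open>Y\<close> is what keeps it in
  one piece.
\<close>

definition reconnect :: "'a list \<Rightarrow> 'a \<Rightarrow> 'a list \<Rightarrow> 'a \<Rightarrow> 'a list" where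
  "reconnect X u Y v = X @ [u] @ rev Y @ [v]"

lemma arcs_reconnect:
  assumes "X \<noteq> []" "Y \<noteq> []"
  shows "arcs (reconnect X u Y v) =
    steps X \<union> (steps Y)\<inverse> \<union> {(last X, u), (u, last Y), (hd Y, v), (v, hd X)}"
  using assms
  by (simp add: arcs_def reconnect_def steps_append steps_Cons steps_rev hd_rev last_rev hd_append)
     blast

lemma links_reconnect:
  assumes "X \<noteq> []" "Y \<noteq> []"
  shows "links (reconnect X u Y v) = steps X \<union> (steps X)\<inverse> \<union> steps Y \<union> (steps Y)\<inverse> \<union>
    {(last X, u), (u, last Y), (hd Y, v), (v, hd X), (u, last X), (last Y, u), (v, hd Y), (hd X, v)}"
  using assms by (auto simp: links_def arcs_reconnect)

section \<open>Cycles in the incidence graph\<close>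

definition levi :: "('p \<Rightarrow> 'l \<Rightarrow> bool) \<Rightarrow> (('p + 'l) \<times> ('p + 'l)) set" where
  "levi inc = {(Inl p, Inr l) | p l. inc p l} \<union> {(Inr l, Inl p) | p l. inc p l}"

lemma levi_simps [simp]:
  "(Inl p, Inr l) \<in> levi inc \<longleftrightarrow> inc p l" "(Inr l, Inl p) \<in> levi inc \<longleftrightarrow> inc p l"
  "(Inl p, Inl p') \<notin> levi inc" "(Inr l, Inr l') \<notin> levi inc"
  by (auto simp: levi_def)

lemma sym_levi: "sym (levi inc)"
  by (auto simp: levi_def sym_def)

lemma converse_levi: "R \<subseteq> levi inc \<Longrightarrow> R\<inverse> \<subseteq> levi inc"
  using sym_levi[of inc] by (auto dest: symD)

definition levi_cycle :: "('p \<Rightarrow> 'l \<Rightarrow> bool) \<Rightarrow> nat \<Rightarrow> ('p + 'l) list \<Rightarrow> bool" where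
  "levi_cycle inc k W \<longleftrightarrow>
     distinct W \<and> length W = 2 * k \<and> isl (hd W) \<and> arcs W \<subseteq> levi inc"

lemma nth_step: "Suc i < length W \<Longrightarrow> (W ! i, W ! Suc i) \<in> steps W"
  unfolding steps_def set_zip by (auto simp: nth_tl intro!: exI[of _ i])

text \<open>
  Adjacent entries of the list are of different kinds, so points and lines alternate: the points
  are at the even positions and the lines at the odd ones.
\<close>

lemma levi_cycleE:
  assumes "levi_cycle inc k W" "k > 0"
  obtains p l where "inj_on p {..<k}" "inj_on l {..<k}"
    "\<And>i. i < k \<Longrightarrow> inc (p i) (l i) \<and> inc (p (Suc i mod k)) (l i)"
proof -
  have W: "distinct W" "length W = 2 * k" "isl (hd W)" "arcs W \<subseteq> levi inc"
    using assms by (auto simp: levi_cycle_def)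
  have ne: "W \<noteq> []" using W(2) assms(2) by auto
  have st: "(W ! i, W ! Suc i) \<in> levi inc" if "Suc i < 2 * k" for i
    using nth_step[of i W] that W by (auto simp: arcs_def)
  have wrap: "(W ! (2 * k - 1), W ! 0) \<in> levi inc"
    using W ne by (auto simp: arcs_def hd_conv_nth last_conv_nth)
  have isl: "isl (W ! i) \<longleftrightarrow> even i" if "i < 2 * k" for i
    using that
  proof (induction i)
    case 0
    then show ?case using W(3) ne by (simp add: hd_conv_nth)
  next
    case (Suc i)
    then show ?case using st[of i] by (cases "W ! i"; cases "W ! Suc i") auto
  qed
  define p where "p i = projl (W ! (2 * i))" for i
  define l where "l i = projr (W ! (2 * i + 1))" for i
  have p: "W ! (2 * i) = Inl (p i)" if "i < k" for i
    using isl[of "2 * i"] that by (simp add: p_def)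
  have l: "W ! Suc (2 * i) = Inr (l i)" if "i < k" for i
    using isl[of "2 * i + 1"] that by (simp add: l_def sum.expand)
  show ?thesis
  proof
    show "inj_on p {..<k}"
    proof (rule inj_onI)
      fix i j assume "i \<in> {..<k}" "j \<in> {..<k}" "p i = p j"
      then have "W ! (2 * i) = W ! (2 * j)" "i < k" "j < k" using p by auto
      then show "i = j" using W(1,2) by (simp add: nth_eq_iff_index_eq)
    qed
    show "inj_on l {..<k}"
    proof (rule inj_onI)
      fix i j assume "i \<in> {..<k}" "j \<in> {..<k}" "l i = l j"
      then have "W ! Suc (2 * i) = W ! Suc (2 * j)" "i < k" "j < k" using l by auto
      then show "i = j" using W(1,2) by (simp add: nth_eq_iff_index_eq)
    qed
  next
    fix i assume i: "i < k"
    have "inc (p i) (l i)" using st[of "2 * i"] p[OF i] l[OF i] i by simp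
    moreover have "inc (p (Suc i mod k)) (l i)"
    proof (cases "Suc i < k")
      case True
      then show ?thesis using st[of "Suc (2 * i)"] p[of "Suc i"] l[OF i] by simp
    next
      case False
      then have "k = Suc i" using i by simp
      then show ?thesis using wrap p[of 0] l[OF i] by simp
    qed
    ultimately show "inc (p i) (l i) \<and> inc (p (Suc i mod k)) (l i)" ..
  qed
qed

section \<open>Spirals\<close>

text \<open>
  What the combinatorial argument uses about the plane: the sizes of the rows, which points and
  lines are distinct, and the incidences that the cycles below pass through.
\<close>

locale spirals =
  fixes inc :: "'p \<Rightarrow> 'l \<Rightarrow> bool" and q :: nat
    and A :: "'p set" and row :: "'p \<Rightarrow> nat"
    and out :: "'p \<Rightarrow> 'l" and nxt :: "'p \<Rightarrow> 'p"
    and dir :: "nat \<Rightarrow> 'p" and par :: "nat \<Rightarrow> 'l"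
    and apex :: 'p and axis :: 'l
  assumes q: "q \<ge> 2"
    and card_row: "i < q \<Longrightarrow> card {p \<in> A. row p = i} = q"
    and row_less: "p \<in> A \<Longrightarrow> row p < q"
    and finite_A: "finite A"
    and nxt_in: "p \<in> A \<Longrightarrow> nxt p \<in> A"
    and inj_nxt: "inj_on nxt A"
    and row_nxt: "p \<in> A \<Longrightarrow> row (nxt p) = Suc (row p) mod q"
    and inj_out: "inj_on out A"
    and inj_dir: "inj_on dir {..<q}"
    and inj_par: "inj_on par {..<q}"
    and inc_out: "p \<in> A \<Longrightarrow> inc p (out p)"
    and inc_nxt: "p \<in> A \<Longrightarrow> inc (nxt p) (out p)"
    and inc_dir: "p \<in> A \<Longrightarrow> inc (dir (row p)) (out p)"
    and inc_par: "p \<in> A \<Longrightarrow> inc p (par (row p))"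
    and dir_axis: "i < q \<Longrightarrow> inc (dir i) axis"
    and apex_axis: "inc apex axis"
    and apex_par: "i < q \<Longrightarrow> inc apex (par i)"
    and dir_notin: "i < q \<Longrightarrow> dir i \<notin> A"
    and apex_notin: "apex \<notin> A"
    and dir_apex: "i < q \<Longrightarrow> dir i \<noteq> apex"
    and par_out: "i < q \<Longrightarrow> p \<in> A \<Longrightarrow> par i \<noteq> out p"
    and axis_out: "p \<in> A \<Longrightarrow> axis \<noteq> out p"
    and axis_par: "i < q \<Longrightarrow> axis \<noteq> par i"
begin

lemma nxt_neq: "p \<in> A \<Longrightarrow> nxt p \<noteq> p"
  using row_nxt[of p] row_less[of p] q by (auto simp: mod_Suc split: if_splits)

lemma funpow_in: "p \<in> A \<Longrightarrow> (nxt ^^ i) p \<in> A"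
  by (induction i) (auto intro: nxt_in)

lemma funpow_row: "p \<in> A \<Longrightarrow> row ((nxt ^^ i) p) = (row p + i) mod q"
  by (induction i) (auto simp: row_less row_nxt funpow_in mod_Suc_eq)

lemma card_A: "card A = q * q"
proof -
  have "A = (\<Union>i\<in>{..<q}. {p \<in> A. row p = i})" using row_less by auto
  then have "card A = card (\<Union>i\<in>{..<q}. {p \<in> A. row p = i})" by simp
  also have "\<dots> = (\<Sum>i\<in>{..<q}. card {p \<in> A. row p = i})"
    by (rule card_UN_disjoint) (auto simp: finite_A)
  finally show ?thesis using card_row by simp
qed

lemma ex_row: "i < q \<Longrightarrow> \<exists>p\<in>A. row p = i"
  using card_row[of i] q by (cases "{p \<in> A. row p = i} = {}") auto

text \<open>
  The closed sets are the unions of spirals.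
\<close>

definition closed :: "'p set \<Rightarrow> bool" where
  "closed B \<longleftrightarrow> B \<subseteq> A \<and> nxt ` B = B"

lemma closed_A: "closed A"
  using endo_inj_surj[OF finite_A _ inj_nxt] nxt_in by (auto simp: closed_def)

lemma closed_Un: "closed B \<Longrightarrow> closed C \<Longrightarrow> closed (B \<union> C)"
  unfolding closed_def by blast

lemma closed_Diff: "closed B \<Longrightarrow> closed (A - B)"
  using closed_A inj_on_image_set_diff[OF inj_nxt, of A B] unfolding closed_def by auto

lemma closed_row:
  assumes "closed B" "B \<noteq> {}" "i < q"
  shows "\<exists>p\<in>B. row p = i"
proof -
  obtain y where y: "y \<in> B" "y \<in> A" using assms by (auto simp: closed_def)
  have inB: "(nxt ^^ n) y \<in> B" for n
    by (induction n) (use y assms(1) in \<open>auto simp: closed_def\<close>)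
  have "row ((nxt ^^ (i + (q - row y))) y) = i"
    using funpow_row[OF y(2)] row_less[OF y(2)] assms(3) by simp
  then show ?thesis using inB by blast
qed

text \<open>
  The powers of \<open>nxt\<close> cannot be pairwise different on a finite set, and as \<open>nxt\<close> is injective the
  first repetition is a return to \<open>y\<close>. The spiral of \<open>y\<close> is listed once by the exponents up to \<open>n\<close>.
\<close>

lemma orbit:
  assumes y: "y \<in> A"
  obtains n S where "S = (\<lambda>i. (nxt ^^ i) y) ` {..n}" "inj_on (\<lambda>i. (nxt ^^ i) y) {..n}"
    "nxt ((nxt ^^ n) y) = y" "closed S" "y \<in> S"
    "\<forall>B. closed B \<longrightarrow> y \<notin> B \<longrightarrow> B \<inter> S = {}"
proof -
  have "\<not> inj (\<lambda>i. (nxt ^^ i) y)"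
    using finite_subset[OF _ finite_A] funpow_in[OF y] infinite_UNIV_nat
    by (metis (no_types, lifting) finite_imageD image_subsetI)
  then obtain i j where "i < j" "(nxt ^^ i) y = (nxt ^^ j) y"
    by (metis (mono_tags, lifting) injI linorder_neqE_nat)
  have return: "(nxt ^^ (j - i)) y = y" if "i \<le> j" "(nxt ^^ i) y = (nxt ^^ j) y" for i j
    using that
  proof (induction i arbitrary: j)
    case (Suc i)
    then obtain j' where "j = Suc j'" by (cases j) auto
    with Suc show ?case using inj_onD[OF inj_nxt] funpow_in[OF y] by auto
  qed simp
  define P where "P m \<longleftrightarrow> (nxt ^^ Suc m) y = y" for m
  have "P (j - i - 1)" using return[of i j] \<open>i < j\<close> \<open>(nxt ^^ i) y = (nxt ^^ j) y\<close>
    by (simp add: P_def Suc_diff_Suc del: funpow.simps)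
  then have "P (LEAST n. P n)" by (rule LeastI)
  moreover define n where "n = (LEAST n. P n)"
  ultimately have n: "nxt ((nxt ^^ n) y) = y" by (simp add: P_def)
  have inj: "inj_on (\<lambda>i. (nxt ^^ i) y) {..n}"
  proof (rule linorder_inj_onI)
    fix i j assume ij: "i < j" "i \<in> {..n}" "j \<in> {..n}"
    show "(nxt ^^ i) y \<noteq> (nxt ^^ j) y"
    proof
      assume "(nxt ^^ i) y = (nxt ^^ j) y"
      then have "P (j - i - 1)" using return[of i j] ij(1)
        by (simp add: P_def Suc_diff_Suc del: funpow.simps)
      then have "n \<le> j - i - 1" unfolding n_def by (rule Least_le)
      then show False using ij by auto
    qed
  qed auto
  let ?S = "(\<lambda>i. (nxt ^^ i) y) ` {..n}"
  have "nxt ` ?S \<subseteq> ?S"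
  proof clarify
    fix i assume "i \<le> n"
    show "nxt ((nxt ^^ i) y) \<in> ?S"
    proof (cases "i = n")
      case True
      then show ?thesis using n by (auto intro!: image_eqI[of _ _ 0])
    next
      case False
      then show ?thesis using \<open>i \<le> n\<close> by (auto intro!: image_eqI[of _ _ "Suc i"])
    qed
  qed
  moreover have "?S \<subseteq> A" using funpow_in[OF y] by auto
  ultimately have "closed ?S"
    using endo_inj_surj[of ?S nxt] inj_on_subset[OF inj_nxt] by (auto simp: closed_def)
  moreover have "y \<in> ?S" by (rule image_eqI[of _ _ 0]) auto
  moreover have "B \<inter> ?S = {}" if "closed B" "y \<notin> B" for B
  proof -
    have "(nxt ^^ i) y \<in> A - B" for i
      by (induction i) (use closed_Diff[OF that(1)] that(2) y in \<open>auto simp: closed_def\<close>)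
    then show ?thesis by blast
  qed
  ultimately show ?thesis using that[of ?S n] inj n by auto
qed

text \<open>
  The walk along a spiral from \<open>y\<close> that takes \<open>n\<close> steps and ends at a point, so that it visits
  \<open>n + 1\<close> points but only \<open>n\<close> lines.
\<close>

primrec spiral :: "'p \<Rightarrow> nat \<Rightarrow> ('p + 'l) list" where
  "spiral y 0 = [Inl y]"
| "spiral y (Suc n) = spiral y n @ [Inr (out ((nxt ^^ n) y)), Inl ((nxt ^^ Suc n) y)]"

lemma spiral_nonempty [simp]: "spiral y n \<noteq> []"
  by (cases n) auto

lemma hd_spiral [simp]: "hd (spiral y n) = Inl y"
  by (induction n) (auto simp: hd_append)

lemma last_spiral [simp]: "last (spiral y n) = Inl ((nxt ^^ n) y)"
  by (cases n) auto

lemma length_spiral [simp]: "length (spiral y n) = 2 * n + 1"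
  by (induction n) auto

lemma set_spiral:
  "set (spiral y n) =
     Inl ` (\<lambda>i. (nxt ^^ i) y) ` {..n} \<union> Inr ` out ` (\<lambda>i. (nxt ^^ i) y) ` {..<n}"
  by (induction n) (auto simp: atMost_Suc lessThan_Suc)

lemma steps_spiral:
  "steps (spiral y n) = (\<Union>i<n. {(Inl ((nxt ^^ i) y), Inr (out ((nxt ^^ i) y))),
     (Inr (out ((nxt ^^ i) y)), Inl (nxt ((nxt ^^ i) y)))})"
  by (induction n) (auto simp: steps_append lessThan_Suc)

lemma steps_spiral_levi: "y \<in> A \<Longrightarrow> steps (spiral y n) \<subseteq> levi inc"
  using funpow_in inc_out inc_nxt by (auto simp: steps_spiral)

lemma distinct_spiral:
  assumes "y \<in> A" "inj_on (\<lambda>i. (nxt ^^ i) y) {..n}"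
  shows "distinct (spiral y n)"
  using assms(2)
proof (induction n)
  case (Suc n)
  have 1: "distinct (spiral y n)"
    using Suc.IH inj_on_subset[OF Suc.prems, of "{..n}"] by auto
  have "out ((nxt ^^ n) y) \<noteq> out ((nxt ^^ i) y)" if "i < n" for i
    using inj_onD[OF Suc.prems, of n i] inj_onD[OF inj_out, of "(nxt ^^ n) y" "(nxt ^^ i) y"]
      funpow_in[OF assms(1)] that by auto
  moreover have "(nxt ^^ Suc n) y \<noteq> (nxt ^^ i) y" if "i \<le> n" for i
    using inj_onD[OF Suc.prems, of "Suc n" i] that by auto
  ultimately show ?case using 1 by (auto simp: set_spiral simp del: funpow.simps)
qed simp

lemma dir_eq: "i < q \<Longrightarrow> j < q \<Longrightarrow> dir i = dir j \<longleftrightarrow> i = j"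
  using inj_on_eq_iff[OF inj_dir] by auto

lemma par_eq: "i < q \<Longrightarrow> j < q \<Longrightarrow> par i = par j \<longleftrightarrow> i = j"
  using inj_on_eq_iff[OF inj_par] by auto

lemma out_eq: "x \<in> A \<Longrightarrow> y \<in> A \<Longrightarrow> out x = out y \<longleftrightarrow> x = y"
  using inj_on_eq_iff[OF inj_out] by auto

lemma orbit_cycle:
  assumes y: "y \<in> A"
  obtains S W where "closed S" "y \<in> S" "\<forall>B. closed B \<longrightarrow> y \<notin> B \<longrightarrow> B \<inter> S = {}"
    "W \<noteq> []" "distinct W" "set W = Inl ` S \<union> Inr ` out ` S" "length W = 2 * card S"
    "arcs W = (\<Union>p\<in>S. {(Inl p, Inr (out p)), (Inr (out p), Inl (nxt p))})"
proof -
  obtain n S where S: "S = (\<lambda>i. (nxt ^^ i) y) ` {..n}" and inj: "inj_on (\<lambda>i. (nxt ^^ i) y) {..n}"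
    and n: "nxt ((nxt ^^ n) y) = y"
    and rest: "closed S" "y \<in> S" "\<forall>B. closed B \<longrightarrow> y \<notin> B \<longrightarrow> B \<inter> S = {}"
    by (rule orbit[OF y])
  define W where "W = spiral y n @ [Inr (out ((nxt ^^ n) y))]"
  have "out ((nxt ^^ n) y) \<noteq> out ((nxt ^^ i) y)" if "i < n" for i
    using inj_onD[OF inj, of n i] inj_onD[OF inj_out, of "(nxt ^^ n) y" "(nxt ^^ i) y"]
      funpow_in[OF y] that by auto
  then have "distinct W"
    using distinct_spiral[OF y inj] by (auto simp: W_def set_spiral)
  moreover have "{..n} = insert n {..<n}" by auto
  then have "set W = Inl ` S \<union> Inr ` out ` S" unfolding W_def S by (auto simp: set_spiral)
  moreover have "length W = 2 * card S"
    unfolding W_def S by (simp add: card_image[OF inj])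
  moreover have "arcs W = (\<Union>p\<in>S. {(Inl p, Inr (out p)), (Inr (out p), Inl (nxt p))})"
  proof -
    have "arcs W = insert (Inr (out ((nxt ^^ n) y)), Inl y)
        (insert (Inl ((nxt ^^ n) y), Inr (out ((nxt ^^ n) y))) (steps (spiral y n)))"
      unfolding W_def by (simp add: arcs_def steps_append hd_append)
    also have "\<dots> = (\<Union>p\<in>S. {(Inl p, Inr (out p)), (Inr (out p), Inl (nxt p))})"
      unfolding S steps_spiral \<open>{..n} = insert n {..<n}\<close> using n by auto
    finally show ?thesis .
  qed
  moreover have "W \<noteq> []" by (simp add: W_def)
  ultimately show ?thesis using that[of S W] rest by blast
qed

text \<open>
  The state after rows \<open>0, \<dots>, t - 1\<close> have been treated: one cycle through the spirals that make up
  \<open>B\<close>, with one extra point and one extra line for each treated row. The incidences between \<open>p\<close> and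
  \<open>out p\<close> are never given up; those between \<open>out p\<close> and \<open>nxt p\<close> are available in the rows to come,
  and for \<open>t = 0\<close> they are all traversed in the direction of \<open>nxt\<close>. The last condition stands
  for the number of spirals in \<open>B\<close>: as long as one is missing, \<open>t\<close> mergers have united \<open>t + 1\<close> of them,
  and each has a point in row \<open>0\<close>.
\<close>

definition ring :: "'p set \<Rightarrow> nat \<Rightarrow> ('p + 'l) list \<Rightarrow> bool" where
  "ring B t W \<longleftrightarrow> closed B \<and> B \<noteq> {} \<and> t < q \<and> W \<noteq> [] \<and> distinct W \<and>
     set W = Inl ` (B \<union> dir ` {..<t}) \<union> Inr ` (out ` B \<union> par ` {1..t}) \<and>
     length W = 2 * (card B + t) \<and> links W \<subseteq> levi inc \<and>
     (\<forall>p\<in>B. (Inl p, Inr (out p)) \<in> links W) \<and>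
     (\<forall>p\<in>B. t \<le> row p \<longrightarrow> (Inr (out p), Inl (nxt p)) \<in> links W) \<and>
     (t = 0 \<longrightarrow> (\<forall>p\<in>B. (Inr (out p), Inl (nxt p)) \<in> arcs W)) \<and>
     (B = A \<or> t < card {p \<in> B. row p = 0})"

lemma finite_closed: "closed B \<Longrightarrow> finite B"
  using finite_A finite_subset by (auto simp: closed_def)

lemma card_closed_row:
  assumes "closed B" "B \<noteq> {}" "i < q"
  shows "0 < card {p \<in> B. row p = i}"
  using closed_row[OF assms] finite_closed[OF assms(1)] by (auto simp: card_gt_0_iff)

lemma card_row_Un:
  assumes "closed B" "closed S" "B \<inter> S = {}"
  shows "card {p \<in> B \<union> S. row p = i} = card {p \<in> B. row p = i} + card {p \<in> S. row p = i}"
proof -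
  have "{p \<in> B \<union> S. row p = i} = {p \<in> B. row p = i} \<union> {p \<in> S. row p = i}" by auto
  then show ?thesis
    using assms finite_closed by (auto intro!: card_Un_disjoint)
qed

text \<open>
  A missing spiral would contribute a point to each row.
\<close>

lemma card_row_le:
  assumes "closed B" "B \<noteq> A" "i < q"
  shows "card {p \<in> B. row p = i} < q"
proof -
  have "closed (A - B)" "A - B \<noteq> {}" using assms closed_Diff by (auto simp: closed_def)
  then have "0 < card {p \<in> A - B. row p = i}" using card_closed_row assms by blast
  moreover have "B \<union> (A - B) = A" using assms by (auto simp: closed_def)
  ultimately show ?thesis
    using card_row_Un[of B "A - B" i] assms \<open>closed (A - B)\<close> card_row[of i] by auto
qed

lemma ring_start: "\<exists>B W. ring B 0 W"
proof -
  obtain y where y: "y \<in> A" using ex_row[of 0] q by auto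
  obtain S W where SW: "closed S" "y \<in> S" and "\<forall>B. closed B \<longrightarrow> y \<notin> B \<longrightarrow> B \<inter> S = {}"
    and W: "W \<noteq> []" "distinct W"
    "set W = Inl ` S \<union> Inr ` out ` S" "length W = 2 * card S"
    "arcs W = (\<Union>p\<in>S. {(Inl p, Inr (out p)), (Inr (out p), Inl (nxt p))})"
    by (rule orbit_cycle[OF y])
  have "arcs W \<subseteq> levi inc" using SW(1) W(5) inc_out inc_nxt by (auto simp: closed_def)
  then have "links W \<subseteq> levi inc" using converse_levi[of "arcs W" inc] by (simp add: links_def)
  moreover have "(Inl p, Inr (out p)) \<in> arcs W" "(Inr (out p), Inl (nxt p)) \<in> arcs W"
    if "p \<in> S" for p
    using that unfolding W(5) by blast+
  moreover have "0 < card {p \<in> S. row p = 0}" using card_closed_row[of S 0] SW(1,2) q by auto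
  moreover have "S \<noteq> {}" using SW(2) by blast
  ultimately have "ring S 0 W"
    using SW W(1-4) q unfolding ring_def links_def by simp
  then show ?thesis by blast
qed

text \<open>
  The common core of merging and rerouting. In both cases \<open>X\<close> and \<open>Y\<close> end with the lines of two points
  of row \<open>t\<close> and start with the successors of these points, but in rerouting the two successors
  are swapped; the points \<open>r, r'\<close> leave this open.
\<close>

lemma ring_reconnect:
  assumes B: "closed B" and p: "p \<in> B" "p' \<in> B" "row p = t" "row p' = t" and t: "Suc t < q"
    and XY: "distinct (X @ Y)" "X \<noteq> []" "Y \<noteq> []"
    and set: "set (X @ Y) = Inl ` (B \<union> dir ` {..<t}) \<union> Inr ` (out ` B \<union> par ` {1..t})"
    and len: "length (X @ Y) = 2 * (card B + t)"
    and last: "last X = Inr (out p)" "last Y = Inr (out p')"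
    and hd: "hd X = Inl (nxt r)" "hd Y = Inl (nxt r')" "r \<in> {p, p'}" "r' \<in> {p, p'}"
    and steps: "steps X \<subseteq> levi inc" "steps Y \<subseteq> levi inc"
    and keep: "\<And>r. r \<in> B \<Longrightarrow>
        (Inl r, Inr (out r)) \<in> steps X \<union> (steps X)\<inverse> \<union> steps Y \<union> (steps Y)\<inverse>"
      "\<And>r. r \<in> B \<Longrightarrow> Suc t \<le> row r \<Longrightarrow>
        (Inr (out r), Inl (nxt r)) \<in> steps X \<union> (steps X)\<inverse> \<union> steps Y \<union> (steps Y)\<inverse>"
    and card: "B = A \<or> Suc t < card {p \<in> B. row p = 0}"
  shows "ring B (Suc t) (reconnect X (Inl (dir t)) Y (Inr (par (Suc t))))"
proof -
  let ?W = "reconnect X (Inl (dir t)) Y (Inr (par (Suc t)))"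
  have BA: "B \<subseteq> A" using B by (auto simp: closed_def)
  have dir_new: "Inl (dir t) \<notin> set (X @ Y)"
    unfolding set using dir_notin[of t] t BA by (auto simp: dir_eq)
  have par_new: "Inr (par (Suc t)) \<notin> set (X @ Y)"
    unfolding set using par_out[of "Suc t"] t BA by (auto simp: par_eq)
  have dist: "distinct ?W"
    using XY(1) dir_new par_new by (auto simp: reconnect_def)
  have ivl: "{..<Suc t} = insert t {..<t}" "{1..Suc t} = insert (Suc t) {1..t}" by auto
  have "set ?W = insert (Inl (dir t)) (insert (Inr (par (Suc t))) (set (X @ Y)))"
    by (auto simp: reconnect_def)
  then have set': "set ?W =
      Inl ` (B \<union> dir ` {..<Suc t}) \<union> Inr ` (out ` B \<union> par ` {1..Suc t})"
    unfolding set ivl by blast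
  have rows: "row (nxt p) = Suc t" "row (nxt p') = Suc t"
    using row_nxt p BA t by auto
  have "inc (dir t) (out p)" "inc (dir t) (out p')"
    using inc_dir[of p] inc_dir[of p'] p BA by auto
  moreover have "inc (nxt r) (par (Suc t))" "inc (nxt r') (par (Suc t))"
    using inc_par[of "nxt r"] inc_par[of "nxt r'"] rows p BA hd nxt_in by auto
  ultimately have "links ?W \<subseteq> levi inc"
    unfolding links_reconnect[OF XY(2,3)] last hd
    using steps steps[THEN converse_levi] by auto
  moreover have "?W \<noteq> []" by (simp add: reconnect_def)
  moreover have "length ?W = 2 * (card B + Suc t)" using len by (simp add: reconnect_def)
  moreover have sub: "steps X \<union> (steps X)\<inverse> \<union> steps Y \<union> (steps Y)\<inverse> \<subseteq> links ?W"
    unfolding links_reconnect[OF XY(2,3)] by blast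
  moreover have "B \<noteq> {}" using p by blast
  ultimately show ?thesis
    unfolding ring_def using B t dist set' card subsetD[OF sub keep(1)] subsetD[OF sub keep(2)]
    by simp
qed

lemma links_cut:
  assumes "W \<noteq> []" "(x, y) \<in> links W" "(x, y) \<noteq> (last W, hd W)" "(x, y) \<noteq> (hd W, last W)"
  shows "(x, y) \<in> steps W \<union> (steps W)\<inverse>"
  using assms by (auto simp: links_def arcs_def)

lemma disjoint_mono: "X \<subseteq> U \<Longrightarrow> U \<inter> V = {} \<Longrightarrow> X \<inter> V = {}"
  by blast

lemma closed_disjoint:
  assumes "closed B" "closed S" "B \<inter> S = {}"
  shows "(Inl ` (B \<union> dir ` {..<q}) \<union> Inr ` (out ` B \<union> par ` {..<q})) \<inter>
    (Inl ` S \<union> Inr ` out ` S) = {}"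
proof -
  have BS: "B \<subseteq> A" "S \<subseteq> A" using assms by (auto simp: closed_def)
  have "dir i \<notin> S" "par i \<notin> out ` S" if "i < q" for i
    using that dir_notin par_out BS by auto
  then have "dir ` {..<q} \<inter> S = {}" "par ` {..<q} \<inter> out ` S = {}" by auto
  moreover have "out ` B \<inter> out ` S = {}"
    using assms(3) inj_on_image_Int[OF inj_out BS] by auto
  ultimately show ?thesis using assms(3) by blast
qed

lemma ring_merge:
  assumes R: "ring B t W" and t: "Suc t < q" and BA: "B \<noteq> A"
  shows "\<exists>B' W'. ring B' (Suc t) W'"
proof -
  have B: "closed B" "B \<noteq> {}" "W \<noteq> []" "distinct W"
    "set W = Inl ` (B \<union> dir ` {..<t}) \<union> Inr ` (out ` B \<union> par ` {1..t})"
    "length W = 2 * (card B + t)" "links W \<subseteq> levi inc"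
    "\<And>p. p \<in> B \<Longrightarrow> (Inl p, Inr (out p)) \<in> links W"
    "\<And>p. p \<in> B \<Longrightarrow> t \<le> row p \<Longrightarrow> (Inr (out p), Inl (nxt p)) \<in> links W"
    "t < card {p \<in> B. row p = 0}"
    using R BA by (auto simp: ring_def)
  have BA': "B \<subseteq> A" using B by (auto simp: closed_def)
  obtain p where p: "p \<in> B" "row p = t" using closed_row[OF B(1,2)] t by (meson Suc_lessD)
  have "closed (A - B)" "A - B \<noteq> {}" using B BA BA' closed_Diff by auto
  then obtain p' where p': "p' \<in> A" "p' \<notin> B" "row p' = t"
    using closed_row t by (metis DiffE Suc_lessD)
  obtain S Z where S: "closed S" "p' \<in> S" "\<forall>B. closed B \<longrightarrow> p' \<notin> B \<longrightarrow> B \<inter> S = {}" and Z: "Z \<noteq> []" "distinct Z"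
    "set Z = Inl ` S \<union> Inr ` out ` S" "length Z = 2 * card S"
    "arcs Z = (\<Union>p\<in>S. {(Inl p, Inr (out p)), (Inr (out p), Inl (nxt p))})"
    by (rule orbit_cycle[OF p'(1)])
  have S: "closed S" "p' \<in> S" "B \<inter> S = {}" using S B(1) p'(2) by auto
  have SA: "S \<subseteq> A" using S by (auto simp: closed_def)
  obtain X where X: "hd X = Inl (nxt p)" "last X = Inr (out p)" "links X = links W"
    "set X = set W" "distinct X" "length X = length W"
    using cut_link[OF B(9)[OF p(1)]] p B(3,4) by auto
  have "(Inr (out p'), Inl (nxt p')) \<in> arcs Z" using Z(5) S(2) by auto
  then obtain Y where Y: "hd Y = Inl (nxt p')" "last Y = Inr (out p')" "arcs Y = arcs Z"
    "set Y = set Z" "distinct Y" "length Y = length Z"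
    using cut_arc Z(1,2) by metis
  have ne: "X \<noteq> []" "Y \<noteq> []" using X(6) Y(6) B(3) Z(1) by auto
  have stX: "steps X \<subseteq> levi inc" using steps_links[of X] X(3) B(7) by simp
  have "arcs Z \<subseteq> levi inc" unfolding Z(5) using SA inc_out inc_nxt by auto
  then have stY: "steps Y \<subseteq> levi inc" using steps_arcs[of Y] unfolding Y(3) by (rule order_trans[rotated])
  have disj: "set X \<inter> set Y = {}"
  proof -
    have "set X \<subseteq> Inl ` (B \<union> dir ` {..<q}) \<union> Inr ` (out ` B \<union> par ` {..<q})"
      unfolding X(4) B(5) by (intro Un_mono image_mono order_refl) (use t in auto)
    then show ?thesis
      unfolding Y(4) Z(3) using closed_disjoint[OF B(1) S(1,3)] by (rule disjoint_mono)
  qed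
  have set: "set (X @ Y) =
      Inl ` ((B \<union> S) \<union> dir ` {..<t}) \<union> Inr ` (out ` (B \<union> S) \<union> par ` {1..t})"
    unfolding set_append X(4) Y(4) B(5) Z(3) image_Un by blast
  have len: "length (X @ Y) = 2 * (card (B \<union> S) + t)"
    using X(6) Y(6) B(6) Z(4) S(3) finite_closed B(1) S(1) by (simp add: card_Un_disjoint)
  have keepX: "(Inl r, Inr (out r)) \<in> steps X \<union> (steps X)\<inverse>" if "r \<in> B" for r
    using links_cut[OF ne(1), of "Inl r" "Inr (out r)"] B(8)[OF that] X that BA' p
      nxt_neq[of p] inj_onD[OF inj_out, of r p] by auto
  have keepX': "(Inr (out r), Inl (nxt r)) \<in> steps X \<union> (steps X)\<inverse>"
    if "r \<in> B" "Suc t \<le> row r" for r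
  proof -
    have "out r \<noteq> out p" using that p BA' by (auto simp: out_eq subset_iff)
    then show ?thesis
      using links_cut[OF ne(1), of "Inr (out r)" "Inl (nxt r)"] B(9)[OF that(1)] X that by auto
  qed
  have keepY: "(Inl r, Inr (out r)) \<in> steps Y" if "r \<in> S" for r
    using Z(5) Y that by (auto simp: arcs_def)
  have keepY': "(Inr (out r), Inl (nxt r)) \<in> steps Y" if "r \<in> S" "Suc t \<le> row r" for r
  proof -
    have "(Inr (out r), Inl (nxt r)) \<in> arcs Y" using Z(5) Y(3) that by auto
    moreover have "out r \<noteq> out p'" using inj_onD[OF inj_out, of r p'] that p' SA by auto
    ultimately show ?thesis using Y(2) by (auto simp: arcs_def)
  qed
  have "Suc t < card {p \<in> B \<union> S. row p = 0}"
  proof -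
    have "S \<noteq> {}" using S(2) by blast
    then have "0 < card {p \<in> S. row p = 0}" using card_closed_row[OF S(1), of 0] q by simp
    then show ?thesis unfolding card_row_Un[OF B(1) S(1,3)] using B(10) by linarith
  qed
  then have "ring (B \<union> S) (Suc t) (reconnect X (Inl (dir t)) Y (Inr (par (Suc t))))"
    using disj p p' S keepX keepX' keepY keepY' X Y
    by (intro ring_reconnect[of _ p p' t X Y p p'] closed_Un B(1) t set len stX stY ne) auto
  then show ?thesis by blast
qed

lemma three_of_row:
  assumes "i < q" "q \<ge> 3"
  obtains a b c where "a \<in> A" "b \<in> A" "c \<in> A" "row a = i" "row b = i" "row c = i"
    "a \<noteq> b" "b \<noteq> c" "a \<noteq> c"
proof -
  have "3 \<le> card {p \<in> A. row p = i}" using card_row assms by simp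
  then obtain T where "T \<subseteq> {p \<in> A. row p = i}" "card T = 3"
    by (meson obtain_subset_with_card_n)
  then show ?thesis using that by (auto simp: card_3_iff)
qed

text \<open>
  Opened at the arc from \<open>out p\<close> to \<open>nxt p\<close>, the cycle passes from \<open>out p'\<close> to \<open>nxt p'\<close> somewhere
  inside, in this order because both arcs have the same direction. There it is split into \<open>Y\<close> and
  \<open>X\<close>, which \<open>reconnect\<close> puts together again.
\<close>

lemma ring_twist:
  assumes R: "ring A t W" and t: "Suc t < q"
  shows "\<exists>W'. ring A (Suc t) W'"
proof -
  have W: "W \<noteq> []" "distinct W"
    "set W = Inl ` (A \<union> dir ` {..<t}) \<union> Inr ` (out ` A \<union> par ` {1..t})"
    "length W = 2 * (card A + t)" "links W \<subseteq> levi inc"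
    "\<And>p. p \<in> A \<Longrightarrow> (Inl p, Inr (out p)) \<in> links W"
    "\<And>p. p \<in> A \<Longrightarrow> t \<le> row p \<Longrightarrow> (Inr (out p), Inl (nxt p)) \<in> links W"
    "t = 0 \<Longrightarrow> p \<in> A \<Longrightarrow> (Inr (out p), Inl (nxt p)) \<in> arcs W" for p
    using R by (auto simp: ring_def)
  let ?fwd = "\<lambda>V p. (Inr (out p), Inl (nxt p)) \<in> arcs V"
  have "\<exists>p\<in>A. \<exists>p'\<in>A. p \<noteq> p' \<and> row p = t \<and> row p' = t \<and>
      (?fwd W p \<and> ?fwd W p' \<or> ?fwd (rev W) p \<and> ?fwd (rev W) p')"
  proof (cases "t = 0")
    case True
    \<comment> \<open>Nothing has been reversed yet, so any two points of the row will do.\<close>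
    have "2 \<le> card {p \<in> A. row p = t}" using card_row[of t] t q by simp
    then obtain T where "T \<subseteq> {p \<in> A. row p = t}" "card T = 2"
      by (meson obtain_subset_with_card_n)
    then obtain p p' where "p \<in> A" "p' \<in> A" "p \<noteq> p'" "row p = t" "row p' = t"
      by (auto simp: card_2_iff)
    then show ?thesis using W(8)[OF True] by blast
  next
    case False
    \<comment> \<open>Of three points, two are traversed in the same direction.\<close>
    then obtain a b c where abc: "a \<in> A" "b \<in> A" "c \<in> A" "row a = t" "row b = t" "row c = t"
      "a \<noteq> b" "b \<noteq> c" "a \<noteq> c"
      using three_of_row[of t] t by auto
    have "?fwd W x \<or> ?fwd (rev W) x" if "x \<in> A" "row x = t" for x
      using W(7)[of x] that W(1) by (auto simp: links_def arcs_rev)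
    then show ?thesis using abc by metis
  qed
  then obtain p p' V where p: "p \<in> A" "p' \<in> A" "p \<noteq> p'" "row p = t" "row p' = t"
    and V: "?fwd V p" "?fwd V p'" "V = W \<or> V = rev W" by blast
  have V': "links V = links W" "set V = set W" "distinct V" "length V = length W" "V \<noteq> []"
    using V(3) W(1,2) by (auto simp: links_def arcs_rev)
  obtain U where U: "hd U = Inl (nxt p)" "last U = Inr (out p)" "arcs U = arcs V"
    "set U = set W" "distinct U" "length U = length W"
    using cut_arc[OF V(1) V'(5)] V' by metis
  have U': "links U = links W" using V'(1) U(3) by (simp add: links_def)
  have ne: "U \<noteq> []" using U(6) W(1) by auto
  have out_neq: "out r \<noteq> out p" if "r \<in> A" "r \<noteq> p" for r
    using inj_onD[OF inj_out] that p by blast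
  have "(Inr (out p'), Inl (nxt p')) \<in> steps U"
    using V(2) U(2) out_neq[of p'] p unfolding U(3)[symmetric] by (auto simp: arcs_def)
  then obtain Y X where YX: "U = Y @ X" "Y \<noteq> []" "X \<noteq> []" "last Y = Inr (out p')"
    "hd X = Inl (nxt p')"
    by (rule steps_split)
  have stU: "steps U = steps Y \<union> insert (Inr (out p'), Inl (nxt p')) (steps X)"
    using YX by (simp add: steps_append)
  have "steps U \<subseteq> levi inc" using steps_links[of U] U' W(5) by simp
  then have st: "steps X \<subseteq> levi inc" "steps Y \<subseteq> levi inc" using stU by auto
  have out_neq': "out r \<noteq> out p'" if "r \<in> A" "r \<noteq> p'" for r
    using inj_onD[OF inj_out] that p by blast
  have keep: "(Inl r, Inr (out r)) \<in> steps U \<union> (steps U)\<inverse>" if "r \<in> A" for r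
    using links_cut[OF ne, of "Inl r" "Inr (out r)"] W(6)[OF that] U U' p nxt_neq[of p]
      out_neq[OF that] by auto
  have keep': "(Inr (out r), Inl (nxt r)) \<in> steps U \<union> (steps U)\<inverse>"
    if "r \<in> A" "Suc t \<le> row r" for r
  proof -
    have "r \<noteq> p" using p that(2) by auto
    then have "out r \<noteq> out p" using out_neq that(1) by blast
    then show ?thesis
      using links_cut[OF ne, of "Inr (out r)" "Inl (nxt r)"] W(7)[OF that(1)] that(2)
      by (simp add: U(1,2) U')
  qed
  have "ring A (Suc t) (reconnect X (Inl (dir t)) Y (Inr (par (Suc t))))"
  proof (rule ring_reconnect[of _ p p' t X Y p' p])
    show "distinct (X @ Y)" using U(5) YX(1) by auto
    show "set (X @ Y) = Inl ` (A \<union> dir ` {..<t}) \<union> Inr ` (out ` A \<union> par ` {1..t})"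
      unfolding W(3)[symmetric] U(4)[symmetric] YX(1) set_append by (rule Un_commute)
    show "length (X @ Y) = 2 * (card A + t)" using U(6) W(4) YX(1) by auto
    show "hd Y = Inl (nxt p)" using U(1) YX(1,2) by simp
    show "last X = Inr (out p)" using U(2) YX(1,3) by simp
    fix r assume r: "r \<in> A"
    have "(Inl r, Inr (out r)) \<noteq> (Inl (nxt p'), Inr (out p'))"
      using nxt_neq[OF p(2)] out_neq'[OF r] by blast
    then show "(Inl r, Inr (out r)) \<in> steps X \<union> (steps X)\<inverse> \<union> steps Y \<union> (steps Y)\<inverse>"
      using keep[OF r] unfolding stU by auto
    assume rt: "Suc t \<le> row r"
    then have "out r \<noteq> out p'" using out_neq'[OF r] p(5) by fastforce
    then show "(Inr (out r), Inl (nxt r)) \<in> steps X \<union> (steps X)\<inverse> \<union> steps Y \<union> (steps Y)\<inverse>"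
      using keep'[OF r rt] unfolding stU by auto
  qed (rule closed_A p YX st t insertI1 insertI2 disjI1 refl)+
  then show ?thesis by blast
qed

lemma ex_ring: "t < q \<Longrightarrow> \<exists>B W. ring B t W"
proof (induction t)
  case 0
  show ?case by (rule ring_start)
next
  case (Suc t)
  then obtain B W where "ring B t W" by auto
  then show ?case using ring_merge ring_twist Suc.prems by (cases "B = A") blast+
qed

lemma out_notin_par: "p \<in> A \<Longrightarrow> I \<subseteq> {..<q} \<Longrightarrow> out p \<notin> par ` I"
  using par_out by (metis imageE lessThan_iff subsetD)

text \<open>
  The detour over the axis that closes a walk from row \<open>0\<close>. The line \<open>out z\<close> of the final point
  must not have been used, and neither must the point at which it meets the axis.
\<close>

lemma close_path:
  assumes X: "distinct X" "X \<noteq> []" "steps X \<subseteq> levi inc" "length X + 1 = 2 * k"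
    and ends: "hd X = Inl b" "b \<in> A" "row b = 0" "last X = Inl z" "z \<in> A"
    and sub: "set X \<subseteq> Inl ` (A \<union> dir ` J) \<union> Inr ` (out ` (A - {z}) \<union> par ` I)"
    and J: "J \<subseteq> {..<q} - {row z}" and I: "I \<subseteq> {1..<q}"
  shows "\<exists>W. levi_cycle inc (k + 2) W"
proof -
  have r: "row z < q" "0 < q" using row_less[OF ends(5)] q by auto
  have points: "p \<in> A \<union> dir ` J" if "Inl p \<in> set X" for p using sub that by auto
  have lines: "l \<in> out ` (A - {z}) \<union> par ` I" if "Inr l \<in> set X" for l using sub that by auto
  have "out z \<notin> out ` (A - {z})" using ends(5) by (auto simp: out_eq)
  moreover have "out z \<notin> par ` I" by (rule out_notin_par) (use I ends in auto)
  ultimately have n1: "Inr (out z) \<notin> set X" using lines by blast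
  have "dir (row z) \<notin> A" using dir_notin r by auto
  moreover have "dir (row z) \<notin> dir ` J" using J r by (auto simp: dir_eq)
  ultimately have n2: "Inl (dir (row z)) \<notin> set X" using points by blast
  have "axis \<notin> out ` A" using axis_out by auto
  moreover have "axis \<notin> par ` {..<q}" using axis_par by auto
  ultimately have n3: "Inr axis \<notin> set X" using lines I by fastforce
  have "apex \<notin> dir ` {..<q}" using dir_apex by auto
  then have n4: "Inl apex \<notin> set X" using points apex_notin J by blast
  have "par 0 \<notin> out ` A" using par_out[of 0] r by auto
  moreover have "par 0 \<notin> par ` {1..<q}" by (auto simp: par_eq)
  ultimately have n5: "Inr (par 0) \<notin> set X" using lines I by blast
  have "inc b (par 0)" using inc_par[OF ends(2)] ends(3) by simp
  then have "levi_cycle inc (k + 2)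
      (X @ [Inr (out z), Inl (dir (row z)), Inr axis, Inl apex, Inr (par 0)])"
    using X ends n1 n2 n3 n4 n5 r inc_out inc_dir dir_axis apex_axis apex_par dir_apex[of "row z"]
      par_out[of 0 z] axis_out[of z] axis_par[of 0]
    by (simp add: levi_cycle_def arcs_def steps_append hd_append)
  then show ?thesis ..
qed

text \<open>
  A walk through all points of \<open>B\<close> and \<open>t\<close> points of the axis that starts in row \<open>0\<close> and ends in row
  \<open>d\<close>. The lines \<open>par i\<close> with \<open>0 < i \<le> t\<close> went into the treatment of rows and those with \<open>i > d\<close> into passages
  between spirals. The last condition accounts for the spirals, each of which has a point in row \<open>0\<close>:
  \<open>t + 1\<close> of them come from the preparation and \<open>q - 1 - d\<close> from the passages. It forces
  \<open>t < d\<close> whenever a spiral is missing, so that \<open>par d\<close> is still free.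
\<close>

definition trail :: "'p set \<Rightarrow> nat \<Rightarrow> nat \<Rightarrow> ('p + 'l) list \<Rightarrow> bool" where
  "trail B t d X \<longleftrightarrow> closed B \<and> t \<le> d \<and> d < q \<and> X \<noteq> [] \<and> distinct X \<and> steps X \<subseteq> levi inc \<and>
     (\<exists>b\<in>A. row b = 0 \<and> hd X = Inl b) \<and>
     (\<exists>z\<in>B. row z = d \<and> last X = Inl z \<and>
        set X \<subseteq> Inl ` (B \<union> dir ` {..<t}) \<union> Inr ` (out ` (B - {z}) \<union> par ` ({1..t} \<union> {d<..<q}))) \<and>
     length X + 1 = 2 * (card B + t) \<and>
     (B = A \<or> t + q \<le> card {p \<in> B. row p = 0} + d)"

lemma trail_close:
  assumes "trail B t d X"
  shows "\<exists>W. levi_cycle inc (card B + t + 2) W"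
proof -
  obtain b z where X: "closed B" "t \<le> d" "d < q" "X \<noteq> []" "distinct X" "steps X \<subseteq> levi inc"
    "b \<in> A" "row b = 0" "hd X = Inl b" "z \<in> B" "row z = d" "last X = Inl z"
    and sub: "set X \<subseteq> Inl ` (B \<union> dir ` {..<t}) \<union>
      Inr ` (out ` (B - {z}) \<union> par ` ({1..t} \<union> {d<..<q}))"
    and len: "length X + 1 = 2 * (card B + t)"
    using assms unfolding trail_def by auto
  have BA: "B \<subseteq> A" using X by (auto simp: closed_def)
  have zA: "z \<in> A" using X(10) BA by blast
  have "set X \<subseteq> Inl ` (A \<union> dir ` {..<t}) \<union>
      Inr ` (out ` (A - {z}) \<union> par ` ({1..t} \<union> {d<..<q}))"
    by (rule order_trans[OF sub]) (intro Un_mono image_mono Diff_mono order_refl BA)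
  then show ?thesis
    by (rule close_path[OF X(5,4,6) len X(9,7,8,12) zA]) (use X(2,3,10,11) in auto)
qed

lemma row_last_orbit:
  assumes "y \<in> A" "nxt ((nxt ^^ n) y) = y"
  shows "Suc (row ((nxt ^^ n) y)) mod q = row y"
  using row_nxt[OF funpow_in[OF assms(1)], of n] assms(2) by simp

lemma card_orbit_segment:
  assumes "inj_on (\<lambda>i. (nxt ^^ i) y) {..n}" "m \<le> n"
  shows "card ((\<lambda>i. (nxt ^^ i) y) ` {..m}) = Suc m"
  using inj_on_subset[OF assms(1), of "{..m}"] assms(2) by (simp add: card_image)

lemma orbit_before_last:
  assumes "y \<in> A" "inj_on (\<lambda>i. (nxt ^^ i) y) {..m}"
  shows "(\<lambda>i. (nxt ^^ i) y) ` {..<m} = (\<lambda>i. (nxt ^^ i) y) ` {..m} - {(nxt ^^ m) y}"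
proof -
  have "{..<m} = {..m} - {m}" by auto
  then show ?thesis using inj_on_image_set_diff[OF assms(2), of "{..m}" "{m}"] by auto
qed

text \<open>
  The walk along a single spiral from row \<open>0\<close>, which can be closed after each of its points.
\<close>

lemma trail_start:
  "\<exists>B X. trail B 0 (q - 1) X \<and> (\<forall>k. 1 \<le> k \<and> k \<le> card B \<longrightarrow> (\<exists>W. levi_cycle inc (k + 2) W))"
proof -
  obtain y where y: "y \<in> A" "row y = 0" using ex_row[of 0] q by auto
  obtain n S where S: "S = (\<lambda>i. (nxt ^^ i) y) ` {..n}" and inj: "inj_on (\<lambda>i. (nxt ^^ i) y) {..n}"
    and n: "nxt ((nxt ^^ n) y) = y" and cS: "closed S" and yS: "y \<in> S"
    and "\<forall>B. closed B \<longrightarrow> y \<notin> B \<longrightarrow> B \<inter> S = {}"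
    by (rule orbit[OF y(1)])
  have injm: "inj_on (\<lambda>i. (nxt ^^ i) y) {..m}" if "m \<le> n" for m
    using inj_on_subset[OF inj, of "{..m}"] that by auto
  have cardS: "card S = Suc n" using card_orbit_segment[OF inj] S by simp
  have "Suc (row ((nxt ^^ n) y)) mod q = 0" using row_last_orbit[OF y(1) n] y(2) by simp
  then have rl: "row ((nxt ^^ n) y) = q - 1"
    using row_less[OF funpow_in[OF y(1)], of n] by (auto simp: mod_Suc split: if_splits)
  have "S \<noteq> {}" using yS by blast
  then have "0 < card {p \<in> S. row p = 0}" using card_closed_row[OF cS, of 0] q by simp
  then have "trail S 0 (q - 1) (spiral y n)"
    unfolding trail_def
    using cS q y rl cardS distinct_spiral[OF y(1) inj] steps_spiral_levi[OF y(1)]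
    by (auto simp: S set_spiral orbit_before_last[OF y(1) inj])
  moreover have "\<exists>W. levi_cycle inc (k + 2) W" if k: "1 \<le> k" "k \<le> card S" for k
  proof -
    define m where "m = k - 1"
    have m: "m \<le> n" "k = Suc m" using k cardS by (auto simp: m_def)
    let ?z = "(nxt ^^ m) y"
    have in_A: "(nxt ^^ i) y \<in> A" for i by (rule funpow_in[OF y(1)])
    have "set (spiral y m) \<subseteq> Inl ` (A \<union> dir ` {}) \<union> Inr ` (out ` (A - {?z}) \<union> par ` {})"
      unfolding set_spiral orbit_before_last[OF y(1) injm[OF m(1)]] using in_A by auto
    moreover have "length (spiral y m) + 1 = 2 * k" using m(2) by simp
    ultimately show ?thesis
      by (intro close_path[OF distinct_spiral[OF y(1) injm[OF m(1)]] spiral_nonempty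
            steps_spiral_levi[OF y(1)] _ hd_spiral y last_spiral in_A]) (assumption | simp)+
  qed
  ultimately show ?thesis by blast
qed

text \<open>
  The passage to a new spiral by \<open>par d\<close>. A walk that stops inside the new spiral ends in an arbitrary
  row, and the point of the axis required for closing it is only guaranteed to be free when \<open>t = 0\<close>;
  after the complete spiral, the row is \<open>d - 1 \<ge> t\<close> and closing is possible for every \<open>t\<close>.
\<close>

lemma trail_extend:
  assumes T: "trail B t d X" and BA: "B \<noteq> A"
  obtains B' d' X' where "trail B' t d' X'" "card B < card B'"
    "\<And>k. t = 0 \<Longrightarrow> card B < k \<Longrightarrow> k \<le> card B' \<Longrightarrow> \<exists>W. levi_cycle inc (k + 2) W"
proof -
  obtain b z where X: "closed B" "t \<le> d" "d < q" "X \<noteq> []" "distinct X" "steps X \<subseteq> levi inc"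
    "b \<in> A" "row b = 0" "hd X = Inl b" "z \<in> B" "row z = d" "last X = Inl z"
    and sub: "set X \<subseteq> Inl ` (B \<union> dir ` {..<t}) \<union>
      Inr ` (out ` (B - {z}) \<union> par ` ({1..t} \<union> {d<..<q}))"
    and len: "length X + 1 = 2 * (card B + t)"
    and cnt: "t + q \<le> card {p \<in> B. row p = 0} + d"
    using T BA unfolding trail_def by auto
  have BA': "B \<subseteq> A" using X by (auto simp: closed_def)
  \<comment> \<open>A missing spiral leaves fewer than \<open>q\<close> points of row \<open>0\<close> in \<open>B\<close>.\<close>
  have td: "t < d" using card_row_le[OF X(1) BA, of 0] cnt q by auto
  have "closed (A - B)" "A - B \<noteq> {}" using X BA BA' closed_Diff by auto
  then obtain y where y: "y \<in> A" "y \<notin> B" "row y = d"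
    using closed_row X(3) by (metis DiffE)
  obtain n S where S: "S = (\<lambda>i. (nxt ^^ i) y) ` {..n}" and inj: "inj_on (\<lambda>i. (nxt ^^ i) y) {..n}"
    and n: "nxt ((nxt ^^ n) y) = y" and cS: "closed S" and yS: "y \<in> S"
    and "\<forall>B. closed B \<longrightarrow> y \<notin> B \<longrightarrow> B \<inter> S = {}"
    by (rule orbit[OF y(1)])
  then have BS: "B \<inter> S = {}" using X(1) y(2) by auto
  have SA: "S \<subseteq> A" using cS by (auto simp: closed_def)
  have inS: "(nxt ^^ i) y \<in> S" if "i \<le> n" for i using that S by auto
  have injm: "inj_on (\<lambda>i. (nxt ^^ i) y) {..m}" if "m \<le> n" for m
    using inj_on_subset[OF inj, of "{..m}"] that by auto
  have cardS: "card S = Suc n" using card_orbit_segment[OF inj] S by simp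
  define P where "P m = X @ [Inr (par d)] @ spiral y m" for m
  have par_new: "par d \<notin> out ` A" using par_out X(3) by auto
  have par_new': "par d \<notin> par ` ({1..t} \<union> {d<..<q})" using td X(3) by (auto simp: par_eq)
  have P: "P m \<noteq> []" "hd (P m) = Inl b" "last (P m) = Inl ((nxt ^^ m) y)"
    "length (P m) + 1 = 2 * (card B + t + Suc m)" for m
    using X len by (auto simp: P_def hd_append)
  have stP: "steps (P m) \<subseteq> levi inc" for m
    using X inc_par[of z] inc_par[OF y(1)] y(3) BA' steps_spiral_levi[OF y(1)]
    by (auto simp: P_def steps_append steps_Cons)
  have setP: "set (P m) \<subseteq> Inl ` (B \<union> (\<lambda>i. (nxt ^^ i) y) ` {..m} \<union> dir ` {..<t}) \<union>
      Inr ` (out ` B \<union> out ` ((\<lambda>i. (nxt ^^ i) y) ` {..m} - {(nxt ^^ m) y}) \<union>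
        par ` ({1..t} \<union> {d..<q}))" if "m \<le> n" for m
  proof -
    let ?T = "Inl ` (B \<union> (\<lambda>i. (nxt ^^ i) y) ` {..m} \<union> dir ` {..<t}) \<union>
      Inr ` (out ` B \<union> out ` ((\<lambda>i. (nxt ^^ i) y) ` {..m} - {(nxt ^^ m) y}) \<union>
        par ` ({1..t} \<union> {d..<q}))"
    have "set X \<subseteq> ?T"
      by (rule order_trans[OF sub]) (intro Un_mono image_mono; auto)
    moreover have "Inr (par d) \<in> ?T" using X(3) by (intro UnI2 imageI) auto
    moreover have "set (spiral y m) \<subseteq> ?T"
      unfolding set_spiral orbit_before_last[OF y(1) injm[OF that]]
      by (intro Un_mono image_mono) blast+
    ultimately show ?thesis by (simp add: P_def)
  qed
  have distP: "distinct (P m)" if m: "m \<le> n" for m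
  proof -
    have "set (spiral y m) \<subseteq> Inl ` S \<union> Inr ` out ` S"
      using m inS by (auto simp: set_spiral)
    moreover have "Inr (par d) \<notin> set X"
      using sub par_new par_new' BA' by auto
    moreover have "set X \<subseteq> Inl ` (B \<union> dir ` {..<q}) \<union> Inr ` (out ` B \<union> par ` {..<q})"
    proof -
      have "Inl ` (B \<union> dir ` {..<t}) \<union> Inr ` (out ` (B - {z}) \<union> par ` ({1..t} \<union> {d<..<q}))
        \<subseteq> Inl ` (B \<union> dir ` {..<q}) \<union> Inr ` (out ` B \<union> par ` {..<q})"
        by (intro Un_mono image_mono order_refl) (use X(2,3) in auto)
      then show ?thesis using sub by (rule order_trans[rotated])
    qed
    then have "set X \<inter> (Inl ` S \<union> Inr ` out ` S) = {}"
      using closed_disjoint[OF X(1) cS BS] by (rule disjoint_mono)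
    ultimately show ?thesis
      using distinct_spiral[OF y(1) injm[OF m]] X(5) par_new SA by (auto simp: P_def)
  qed
  have fin: "finite B" "finite S" using finite_closed X(1) cS by auto
  have card_US: "card (B \<union> S) = card B + Suc n" using BS fin cardS by (simp add: card_Un_disjoint)
  have rl: "row ((nxt ^^ n) y) = d - 1"
    using row_last_orbit[OF y(1) n] y(3) td row_less[OF funpow_in[OF y(1)], of n]
    by (auto simp: mod_Suc split: if_splits)
  have "trail (B \<union> S) t (d - 1) (P n)"
    unfolding trail_def
  proof (intro conjI)
    show "closed (B \<union> S)" using closed_Un X(1) cS by blast
    show "\<exists>b\<in>A. row b = 0 \<and> hd (P n) = Inl b" using P X by auto
    show "\<exists>z\<in>B \<union> S. row z = d - 1 \<and> last (P n) = Inl z \<and>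
      set (P n) \<subseteq> Inl ` (B \<union> S \<union> dir ` {..<t}) \<union>
        Inr ` (out ` (B \<union> S - {z}) \<union> par ` ({1..t} \<union> {d - 1<..<q}))"
    proof (intro bexI conjI)
      have "B - {(nxt ^^ n) y} = B" using inS[of n] BS by auto
      moreover have "{d..<q} = {d - 1<..<q}" using td by auto
      ultimately show "set (P n) \<subseteq> Inl ` (B \<union> S \<union> dir ` {..<t}) \<union>
        Inr ` (out ` (B \<union> S - {(nxt ^^ n) y}) \<union> par ` ({1..t} \<union> {d - 1<..<q}))"
        using setP[of n] unfolding S[symmetric] Un_Diff image_Un by simp
    qed (use rl P inS in auto)
    show "B \<union> S = A \<or> t + q \<le> card {p \<in> B \<union> S. row p = 0} + (d - 1)"
    proof -
      have "S \<noteq> {}" using yS by blast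
      then have "0 < card {p \<in> S. row p = 0}" using card_closed_row[OF cS, of 0] q by simp
      then show ?thesis unfolding card_row_Un[OF X(1) cS BS] using cnt td by linarith
    qed
    show "length (P n) + 1 = 2 * (card (B \<union> S) + t)" using P card_US by simp
  qed (use td X P stP distP in auto)
  moreover have "card B < card (B \<union> S)" using card_US by simp
  moreover have "\<exists>W. levi_cycle inc (k + 2) W" if k: "t = 0" "card B < k" "k \<le> card (B \<union> S)" for k
  proof -
    define m where "m = k - card B - 1"
    have m: "m \<le> n" "k = card B + Suc m" using k card_US by (auto simp: m_def)
    let ?z = "(nxt ^^ m) y"
    have z: "?z \<in> S" "?z \<in> A" using inS[OF m(1)] SA by auto
    have "set (P m) \<subseteq> Inl ` (A \<union> dir ` {}) \<union> Inr ` (out ` (A - {?z}) \<union> par ` {1..<q})"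
    proof -
      have "out ` B \<union> out ` ((\<lambda>i. (nxt ^^ i) y) ` {..m} - {?z}) \<subseteq> out ` (A - {?z})"
      proof -
        have "B \<subseteq> A - {?z}" using BA' BS z(1) by blast
        moreover have "(\<lambda>i. (nxt ^^ i) y) ` {..m} - {?z} \<subseteq> A - {?z}"
          using funpow_in[OF y(1)] by auto
        ultimately show ?thesis by blast
      qed
      moreover have "B \<union> (\<lambda>i. (nxt ^^ i) y) ` {..m} \<subseteq> A"
        using BA' funpow_in[OF y(1)] by auto
      moreover have "{1..t} \<union> {d..<q} \<subseteq> {1..<q}" using td k(1) by auto
      ultimately show ?thesis
        by (intro order_trans[OF setP[OF m(1)]] Un_mono image_mono) (use k(1) in auto)
    qed
    moreover have "length (P m) + 1 = 2 * k" using P(4)[of m] k(1) m(2) by simp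
    ultimately show ?thesis
      by (intro close_path[OF distP[OF m(1)] P(1) stP _ P(2) X(7,8) P(3) z(2)]) (assumption | simp)+
  qed
  ultimately show ?thesis using that by blast
qed

lemma trail_finish:
  assumes "trail B t d X"
  shows "(\<exists>W. levi_cycle inc (card A + t + 2) W) \<and>
    (t = 0 \<longrightarrow> (\<forall>k. card B \<le> k \<and> k \<le> card A \<longrightarrow> (\<exists>W. levi_cycle inc (k + 2) W)))"
  using assms
proof (induction "card A - card B" arbitrary: B d X rule: less_induct)
  case less
  have close: "\<exists>W. levi_cycle inc (card B + t + 2) W" by (rule trail_close[OF less.prems])
  show ?case
  proof (cases "B = A")
    case True
    then show ?thesis using close by auto
  next
    case False
    obtain B' d' X' where B': "trail B' t d' X'" "card B < card B'"
      "\<And>k. t = 0 \<Longrightarrow> card B < k \<Longrightarrow> k \<le> card B' \<Longrightarrow> \<exists>W. levi_cycle inc (k + 2) W"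
      using trail_extend[OF less.prems False] by blast
    have "card B' \<le> card A" using B'(1) finite_A by (auto simp: trail_def closed_def card_mono)
    then have IH: "(\<exists>W. levi_cycle inc (card A + t + 2) W) \<and>
      (t = 0 \<longrightarrow> (\<forall>k. card B' \<le> k \<and> k \<le> card A \<longrightarrow> (\<exists>W. levi_cycle inc (k + 2) W)))"
      using less.hyps[OF _ B'(1)] B'(2) by simp
    have "\<exists>W. levi_cycle inc (k + 2) W" if "t = 0" "card B \<le> k" "k \<le> card A" for k
      using close B'(3)[of k] IH that by (cases "k = card B"; cases "k \<le> card B'") auto
    then show ?thesis using IH by blast
  qed
qed

text \<open>
  Row \<open>q - 1\<close> is untreated as \<open>t < q\<close>, so the cycle can be opened between \<open>out z\<close> and \<open>nxt z\<close> for a point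
  \<open>z\<close> of this row; then \<open>nxt z\<close> lies in row \<open>0\<close>. Dropping \<open>out z\<close> leaves a walk that ends at \<open>z\<close>.
\<close>

lemma ring_trail:
  assumes R: "ring B t W"
  shows "\<exists>X. trail B t (q - 1) X"
proof -
  have B: "closed B" "B \<noteq> {}" "t < q" "W \<noteq> []" "distinct W"
    "set W = Inl ` (B \<union> dir ` {..<t}) \<union> Inr ` (out ` B \<union> par ` {1..t})"
    "length W = 2 * (card B + t)" "links W \<subseteq> levi inc"
    "\<And>p. p \<in> B \<Longrightarrow> (Inl p, Inr (out p)) \<in> links W"
    "\<And>p. p \<in> B \<Longrightarrow> t \<le> row p \<Longrightarrow> (Inr (out p), Inl (nxt p)) \<in> links W"
    "B = A \<or> t < card {p \<in> B. row p = 0}"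
    using R by (auto simp: ring_def)
  have BA: "B \<subseteq> A" using B by (auto simp: closed_def)
  obtain z where z: "z \<in> B" "row z = q - 1" using closed_row[OF B(1,2), of "q - 1"] q by auto
  have zA: "z \<in> A" using z BA by auto
  have closing: "(Inr (out z), Inl (nxt z)) \<in> links W" using B(10)[OF z(1)] z(2) B(3) by simp
  obtain V where V: "hd V = Inl (nxt z)" "last V = Inr (out z)" "links V = links W"
    "set V = set W" "distinct V" "length V = length W"
    using cut_link[OF closing B(4)] B(5) by metis
  have ne: "V \<noteq> []" using V(6) B(4) by auto
  define X where "X = butlast V"
  have VX: "V = X @ [Inr (out z)]" using V(2) ne append_butlast_last_id X_def by metis
  then have X_ne: "X \<noteq> []" using V(1) by auto
  have "(Inl z, Inr (out z)) \<in> steps V \<union> (steps V)\<inverse>"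
    using links_cut[OF ne, of "Inl z" "Inr (out z)"] B(9)[OF z(1)] V nxt_neq[OF zA] by auto
  moreover have "steps V = insert (last X, Inr (out z)) (steps X)"
    using X_ne unfolding VX by (simp add: steps_append)
  moreover have "Inr (out z) \<notin> set X" using V(5) VX by auto
  \<comment> \<open>The walk loses only its final line, so \<open>z\<close>, being linked to it, comes just before it.\<close>
  ultimately have last: "last X = Inl z"
    using X_ne by (auto simp: steps_def dest: set_zip_leftD set_zip_rightD list.set_sel(2))
  have st: "steps X \<subseteq> levi inc"
    using steps_links[of V] V(3) B(8) \<open>steps V = _\<close> by auto
  have setX: "set X = set W - {Inr (out z)}" using V(4,5) VX by auto
  have "par i \<noteq> out z" if "i \<in> {1..t}" for i using par_out zA that B(3) by auto
  then have "set X \<subseteq> Inl ` (B \<union> dir ` {..<t}) \<union> Inr ` (out ` (B - {z}) \<union> par ` ({1..t} \<union> {q - 1<..<q}))"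
    unfolding setX B(6) by auto
  moreover have "nxt z \<in> A" "row (nxt z) = 0" using nxt_in row_nxt zA z(2) q by auto
  moreover have "hd X = Inl (nxt z)" using V(1) X_ne VX by simp
  moreover have "length X + 1 = 2 * (card B + t)" using V(6) VX B(7) by simp
  ultimately have "trail B t (q - 1) X"
    unfolding trail_def using B(1,3,11) X_ne V(5) VX st last z by auto
  then show ?thesis by blast
qed

lemma all_cycles:
  assumes "3 \<le> k" "k \<le> q\<^sup>2 + q + 1"
  shows "\<exists>W. levi_cycle inc k W"
proof (cases "k \<le> card A + 2")
  case True
  obtain B X where BX: "trail B 0 (q - 1) X"
    "\<And>k. 1 \<le> k \<Longrightarrow> k \<le> card B \<Longrightarrow> \<exists>W. levi_cycle inc (k + 2) W"
    using trail_start by blast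
  have "\<exists>W. levi_cycle inc (k - 2 + 2) W"
    using BX(2)[of "k - 2"] trail_finish[OF BX(1)] assms True by (cases "k - 2 \<le> card B") auto
  moreover have "k - 2 + 2 = k" using assms by simp
  ultimately show ?thesis by simp
next
  case False
  define t where "t = k - card A - 2"
  have "t < q" "k = card A + t + 2"
    using False assms by (auto simp: t_def card_A power2_eq_square)
  then show ?thesis using ex_ring ring_trail trail_finish by metis
qed

end

section \<open>Spirals in a projective plane\<close>

text \<open>
  The predicate \<open>incident\<close> of a structure is unrestricted outside of its points and lines.
\<close>

definition inc_in :: "('p, 'l) incidence_structure \<Rightarrow> 'p \<Rightarrow> 'l \<Rightarrow> bool" where
  "inc_in \<pi> p l \<longleftrightarrow> p \<in> points \<pi> \<and> l \<in> lines \<pi> \<and> incident \<pi> p l"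

context
  fixes \<pi> :: "('p, 'l) incidence_structure" and q :: nat
  assumes plane: "projective_plane_of_order q \<pi>"
begin

lemma line_unique:
  assumes "inc_in \<pi> a l" "inc_in \<pi> b l" "inc_in \<pi> a m" "inc_in \<pi> b m" "a \<noteq> b"
  shows "l = m"
proof -
  have "\<forall>a\<in>points \<pi>. \<forall>b\<in>points \<pi>. a \<noteq> b \<longrightarrow>
      (\<forall>l\<in>lines \<pi>. \<forall>m\<in>lines \<pi>.
         incident \<pi> a l \<and> incident \<pi> b l \<and> incident \<pi> a m \<and> incident \<pi> b m \<longrightarrow> l = m)"
    using plane by (simp add: projective_plane_of_order_def partial_plane_def)
  then show ?thesis using assms unfolding inc_in_def by blast
qed

lemma join_exists:
  assumes "a \<in> points \<pi>" "b \<in> points \<pi>" "a \<noteq> b"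
  shows "\<exists>l. inc_in \<pi> a l \<and> inc_in \<pi> b l"
  using plane assms unfolding projective_plane_of_order_def inc_in_def by blast

lemma card_range_points: "l \<in> lines \<pi> \<Longrightarrow> card {p. inc_in \<pi> p l} = q + 1"
  using plane by (auto simp: projective_plane_of_order_def regular_plane_def points_on_def inc_in_def)

lemma card_pencil: "p \<in> points \<pi> \<Longrightarrow> card {l. inc_in \<pi> p l} = q + 1"
  using plane by (auto simp: projective_plane_of_order_def regular_plane_def lines_through_def inc_in_def)

text \<open>
  Joining the \<open>q + 1\<close> points of \<open>l\<close> to a point \<open>p\<close> off \<open>l\<close> gives \<open>q + 1\<close> different lines, which are all the
  lines through \<open>p\<close>.
\<close>

lemma lines_meet:
  assumes "l \<in> lines \<pi>" "m \<in> lines \<pi>"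
  shows "\<exists>p. inc_in \<pi> p l \<and> inc_in \<pi> p m"
proof -
  have "{p. inc_in \<pi> p m} \<noteq> {}" using card_range_points[OF assms(2)] by (metis card.empty add_is_0 one_neq_zero)
  then obtain p where p: "inc_in \<pi> p m" by blast
  have pP: "p \<in> points \<pi>" using p by (simp add: inc_in_def)
  show ?thesis
  proof (cases "inc_in \<pi> p l")
    case False
    have "\<forall>x\<in>{x. inc_in \<pi> x l}. \<exists>k. inc_in \<pi> x k \<and> inc_in \<pi> p k"
      using False pP by (metis inc_in_def join_exists mem_Collect_eq)
    then obtain j where j: "\<And>x. inc_in \<pi> x l \<Longrightarrow> inc_in \<pi> x (j x) \<and> inc_in \<pi> p (j x)"
      by (metis mem_Collect_eq)
    have "inj_on j {x. inc_in \<pi> x l}"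
    proof (rule inj_onI)
      fix x y assume xy: "x \<in> {x. inc_in \<pi> x l}" "y \<in> {x. inc_in \<pi> x l}" "j x = j y"
      show "x = y"
      proof (rule ccontr)
        assume "x \<noteq> y"
        then have "j x = l" using line_unique[of x "j x" y l] j[of x] j[of y] xy by auto
        then show False using j xy(1) False by auto
      qed
    qed
    then have "card (j ` {x. inc_in \<pi> x l}) = card {k. inc_in \<pi> p k}"
      using card_range_points[OF assms(1)] card_pencil[OF pP] by (simp add: card_image)
    moreover have "finite {k. inc_in \<pi> p k}"
      using card_pencil[OF pP] by (intro card_ge_0_finite) simp
    moreover have "j ` {x. inc_in \<pi> x l} \<subseteq> {k. inc_in \<pi> p k}" using j by auto
    ultimately have "j ` {x. inc_in \<pi> x l} = {k. inc_in \<pi> p k}" by (intro card_subset_eq) auto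
    then obtain x where "inc_in \<pi> x l" "m = j x" using p by auto
    then show ?thesis using j by blast
  qed (use p in blast)
qed

lemma enumerate_remainder:
  assumes "card S = q + 1" "x \<in> S"
  obtains h where "bij_betw h {..<q} (S - {x})"
proof -
  have "finite S" using assms by (intro card_ge_0_finite) simp
  then have "finite (S - {x})" "card (S - {x}) = q" using assms by auto
  then show ?thesis using ex_bij_betw_nat_finite[of "S - {x}"] that by (auto simp: lessThan_atLeast0)
qed

text \<open>
  The lines \<open>out p\<close> and the points \<open>nxt p\<close> are chosen as joins and intersections. What
  remains rests on two facts: a line other than the axis has only one point on it, and a point other
  than \<open>apex\<close> is on only one line through \<open>apex\<close>.
\<close>

lemma spirals_exist:
  assumes q: "q \<ge> 2"
  obtains A row out nxt dir par apex axis
  where "spirals (inc_in \<pi>) q A row out nxt dir par apex axis"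
proof -
  obtain apex where apex: "apex \<in> points \<pi>"
    using plane has_quadrangle_nonempty unfolding projective_plane_of_order_def by blast
  then have "{l. inc_in \<pi> apex l} \<noteq> {}"
    using card_pencil[of apex] by (metis card.empty add_is_0 one_neq_zero)
  then obtain axis where axis: "inc_in \<pi> apex axis" by blast
  then have axisL: "axis \<in> lines \<pi>" by (simp add: inc_in_def)
  obtain dir where "bij_betw dir {..<q} ({p. inc_in \<pi> p axis} - {apex})"
    using enumerate_remainder[OF card_range_points[OF axisL]] axis by blast
  then have inj_dir: "inj_on dir {..<q}" and im_dir: "dir ` {..<q} = {p. inc_in \<pi> p axis} - {apex}"
    by (auto simp: bij_betw_def)
  then have dir: "inc_in \<pi> (dir i) axis" "dir i \<noteq> apex" if "i < q" for i using that by blast+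
  obtain par where "bij_betw par {..<q} ({l. inc_in \<pi> apex l} - {axis})"
    using enumerate_remainder[OF card_pencil[OF apex]] axis by blast
  then have inj_par: "inj_on par {..<q}" and im_par: "par ` {..<q} = {l. inc_in \<pi> apex l} - {axis}"
    by (auto simp: bij_betw_def)
  then have par: "inc_in \<pi> apex (par i)" "par i \<noteq> axis" if "i < q" for i using that by blast+
  define A where "A = points \<pi> - {p. inc_in \<pi> p axis}"
  have A: "p \<in> points \<pi>" "\<not> inc_in \<pi> p axis" "p \<noteq> apex" if "p \<in> A" for p
    using that axis by (auto simp: A_def)
  have "\<exists>i. i < q \<and> inc_in \<pi> p (par i)" if p: "p \<in> A" for p
  proof -
    obtain l where "inc_in \<pi> p l" "inc_in \<pi> apex l" using join_exists apex A[OF p] by metis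
    moreover from this have "l \<in> par ` {..<q}" using im_par A[OF p] by auto
    ultimately show ?thesis by auto
  qed
  then obtain row where row: "\<And>p. p \<in> A \<Longrightarrow> row p < q \<and> inc_in \<pi> p (par (row p))" by metis
  have row_unique: "row p = i" if "p \<in> A" "i < q" "inc_in \<pi> p (par i)" for p i
    using line_unique[of p "par i" apex "par (row p)"] row[OF that(1)] par A[OF that(1)] that
      inj_onD[OF inj_par, of i "row p"] by auto
  have "\<exists>l. inc_in \<pi> p l \<and> inc_in \<pi> (dir (row p)) l" if p: "p \<in> A" for p
  proof (rule join_exists)
    show "p \<noteq> dir (row p)" using A(2)[OF p] dir(1) row[OF p] by metis
  qed (use A(1)[OF p] dir(1)[of "row p"] row[OF p] in \<open>auto simp: inc_in_def\<close>)
  then obtain out where out: "\<And>p. p \<in> A \<Longrightarrow> inc_in \<pi> p (out p) \<and> inc_in \<pi> (dir (row p)) (out p)"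
    by metis
  have par_mod: "Suc i mod q < q" for i using q by simp
  have "\<exists>x. inc_in \<pi> x (out p) \<and> inc_in \<pi> x (par (Suc (row p) mod q))" if p: "p \<in> A" for p
    using lines_meet out[OF p] par[OF par_mod] by (simp add: inc_in_def)
  then obtain nxt where nxt: "\<And>p. p \<in> A \<Longrightarrow>
      inc_in \<pi> (nxt p) (out p) \<and> inc_in \<pi> (nxt p) (par (Suc (row p) mod q))"
    by metis
  have out_axis: "out p \<noteq> axis" if "p \<in> A" for p using out A that by metis
  have out_dir: "x = dir (row p)" if "p \<in> A" "inc_in \<pi> x (out p)" "inc_in \<pi> x axis" for p x
    using line_unique[of x "out p" "dir (row p)" axis] out dir row out_axis that by blast
  have out_apex: "\<not> inc_in \<pi> apex (out p)" if "p \<in> A" for p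
    using out_dir[OF that] axis dir(2)[of "row p"] row[OF that] by auto
  have par_axis: "x = apex" if "i < q" "inc_in \<pi> x (par i)" "inc_in \<pi> x axis" for x i
    using line_unique[of x "par i" apex axis] par axis that by blast
  have nxt_A: "nxt p \<in> A" if p: "p \<in> A" for p
  proof -
    have "\<not> inc_in \<pi> (nxt p) axis"
      using par_axis[OF par_mod] nxt[OF p] out_apex[OF p] by metis
    then show ?thesis using nxt[OF p] by (auto simp: A_def inc_in_def)
  qed
  have row_nxt: "row (nxt p) = Suc (row p) mod q" if "p \<in> A" for p
    using row_unique[OF nxt_A[OF that] par_mod] nxt[OF that] by blast
  have out_par: "out p \<noteq> par i" if "p \<in> A" "i < q" for p i
    using out_apex par that by metis
  have on_out: "x = y" if "x \<in> A" "y \<in> A" "out x = out y" "row x = row y" for x y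
    using line_unique[of x "out x" y "par (row x)"] out row that out_par[of x "row x"] by metis
  have inj_out: "inj_on out A"
  proof (rule inj_onI)
    fix x y assume xy: "x \<in> A" "y \<in> A" "out x = out y"
    have "dir (row x) = dir (row y)" using out_dir[OF xy(2)] out[OF xy(1)] dir(1) row[OF xy(1)] xy(3) by simp
    then have "row x = row y" using inj_onD[OF inj_dir] row xy by simp
    then show "x = y" using on_out xy by blast
  qed
  have inj_nxt: "inj_on nxt A"
  proof (rule inj_onI)
    fix x y assume xy: "x \<in> A" "y \<in> A" "nxt x = nxt y"
    have "Suc (row x) mod q = Suc (row y) mod q" using row_nxt xy by metis
    then have r: "row x = row y" using row[OF xy(1)] row[OF xy(2)] by (auto simp: mod_Suc split: if_splits)
    have "nxt x \<noteq> dir (row x)" using nxt_A[OF xy(1)] A(2) dir(1) row[OF xy(1)] by metis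
    then have "out x = out y"
      using line_unique[of "nxt x" "out x" "dir (row x)" "out y"] nxt out xy r by metis
    then show "x = y" using on_out xy r by blast
  qed
  have card_row: "card {p \<in> A. row p = i} = q" if i: "i < q" for i
  proof -
    have "{p \<in> A. row p = i} = {p. inc_in \<pi> p (par i)} - {apex}"
      using row row_unique[OF _ i] par_axis[OF i] A(3) by (auto simp: A_def inc_in_def)
    moreover have "card {p. inc_in \<pi> p (par i)} = q + 1"
      using card_range_points par(1)[OF i] by (simp add: inc_in_def)
    ultimately show ?thesis using par(1)[OF i] by (simp add: card_Diff_singleton)
  qed
  have "finite (points \<pi>)"
    using plane by (intro card_ge_0_finite) (simp add: projective_plane_of_order_iff_card_points)
  then have finite_A: "finite A" by (simp add: A_def)
  have "spirals (inc_in \<pi>) q A row out nxt dir par apex axis"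
  proof
    show "nxt p \<in> A" if "p \<in> A" for p by (rule nxt_A[OF that])
    show "dir i \<notin> A" if "i < q" for i using dir(1)[OF that] A(2) by blast
    show "inc_in \<pi> (nxt p) (out p)" if "p \<in> A" for p using nxt[OF that] by blast
    show "axis \<noteq> out p" if "p \<in> A" for p using out_axis[OF that] by (rule not_sym)
    show "par i \<noteq> out p" if "i < q" "p \<in> A" for i p using out_par[OF that(2,1)] by (rule not_sym)
    show "axis \<noteq> par i" if "i < q" for i using par(2)[OF that] by (rule not_sym)
    show "apex \<notin> A" using A(3) by blast
  qed (use q row out axis dir par row_nxt inj_out inj_nxt inj_dir inj_par card_row finite_A in blast)+
  then show ?thesis by (rule that)
qed

end

theorem theorem2:
  fixes q :: nat and \<pi> :: "('p, 'l) incidence_structure"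
  assumes "q \<ge> 2"
    and "projective_plane_of_order q \<pi>"
  shows "\<forall>k. 3 \<le> k \<and> k \<le> q\<^sup>2 + q + 1 \<longrightarrow> cycle_graph k \<hookrightarrow> \<pi>"
proof (intro allI impI)
  fix k assume k: "3 \<le> k \<and> k \<le> q\<^sup>2 + q + 1"
  obtain A row out nxt dir par apex axis
    where "spirals (inc_in \<pi>) q A row out nxt dir par apex axis"
    by (rule spirals_exist[OF assms(2,1)])
  then have "\<exists>W. levi_cycle (inc_in \<pi>) k W"
    using k by (intro spirals.all_cycles) auto
  then obtain W where "levi_cycle (inc_in \<pi>) k W" by blast
  then obtain p l where "inj_on p {..<k}" "inj_on l {..<k}"
    "\<And>i. i < k \<Longrightarrow> inc_in \<pi> (p i) (l i) \<and> inc_in \<pi> (p (Suc i mod k)) (l i)"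
    using levi_cycleE k by (metis less_le_trans zero_less_numeral)
  then show "cycle_graph k \<hookrightarrow> \<pi>"
    using cycle_graph_embeds_iff[of k \<pi>] k unfolding inc_in_def by blast
qed

end
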